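(* Let $(M,\mathcal{H},\langle\cdot,\cdot\rangle)$ be a sub-Riemannian manifold of rank $m$ with $\mathcal{H}=TM$ (so $m=d=\dim M$, and the only compatible metric is the Riemannian metric $g=\langle\cdot,\cdot\rangle$ itself), and let $\mathcal{L}$ be the corresponding horizontal sub-Laplacian. Then in local coordinates $$\mathcal{L}=\frac1m\sum_{i,j=1}^{d}\Big\{\beta^{ij}\frac{\partial^2}{\partial x^i\partial x^j}-\sum_{k=1}^{d}\Gamma^{ijk}g_{ij}\frac{\partial}{\partial x^k}\Big\},$$ and this is $\frac1m$ times the Laplace-Beltrami operator of the Riemannian manifold $(M,g)$.
   Context: $M$ is a connected smooth manifold of dimension $d$; in general a sub-Riemannian manifold of rank $m\le d$ is a triple $(M,\mathcal{H},\langle\cdot,\cdot\rangle)$ with $\mathcal{H}\subset TM$ a smooth rank-$m$ sub-bundle with smoothly varying inner products $\langle\cdot,\cdot\rangle_q$ on its fibers. The bundle map $\beta:T^{\ast}M\to TM$, with image $\mathcal{H}$, is defined by $\langle\beta_q(p),v\rangle_q=p(v)$ for all $p\in T^{\ast}_qM$, $v\in\mathcal{H}_q$. The Hamiltonian is $H(q,p)=\frac12\langle\beta_q(p),\beta_q(p)\rangle_q=\frac12p(\beta_q(p))$, and $\Phi_t$ is the (locally defined) flow on $T^{\ast}M$ of Hamilton's equations, in canonical coordinates $\dot q^i=\partial H/\partial p_i$, $\dot p_i=-\partial H/\partial q^i$. A compatible metric is a Riemannian metric on $M$ whose restriction to each $\mathcal{H}_q\times\mathcal{H}_q$ is $\langle\cdot,\cdot\rangle_q$;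 $g$ also denotes its bundle map $TM\to T^{\ast}M$, $v\mapsto g(\cdot,v)$. $\mathcal{S}^{\mathcal{H}}_x=\{v\in\mathcal{H}_x:\langle v,v\rangle_x=1\}$ and $\mathbb{U}_x$ is the rotationally invariant probability measure on it. The horizontal sub-Laplacian is, for $f\in C_c^\infty(M)$, $$\mathcal{L}f(x)=\int_{\mathcal{S}^{\mathcal{H}}_x}\Big\{\frac{d}{dt}\Big|_{0}\frac{d}{ds}\Big|_{0}f\big(\Phi_{t+s}(x,g(v))\big)\Big\}\,\mathbb{U}_x(dv),$$ where a function $f$ on $M$ is identified with $(x,p)\mapsto f(x)$ on $T^{\ast}M$. In local coordinates $(x^1,\dots,x^d)$: $\beta^{ij}=\langle\beta(dx^i),\beta(dx^j)\rangle$, $g_{ij}=g(\partial/\partial x^i,\partial/\partial x^j)$, and $$\Gamma^{ijk}=-\frac12\sum_{l=1}^{d}\Big\{\beta^{il}\frac{\partial\beta^{jk}}{\partial x^l}+\beta^{jl}\frac{\partial\beta^{ik}}{\partial x^l}-\beta^{lk}\frac{\partial\beta^{ij}}{\partial x^l}\Big\}.$$ *)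

theory Defs
  imports "HOL-Analysis.Analysis"
begin

section \<open>Smooth functions on open subsets of Euclidean space\<close>

definition partial :: "'n \<Rightarrow> (real^'n \<Rightarrow> real) \<Rightarrow> real^'n \<Rightarrow> real" where
  "partial i F x = deriv (\<lambda>t. F (x + t *\<^sub>R axis i 1)) 0"

text \<open>The set \<open>S\<close> is always open below.\<close>

fun ck_on :: "nat \<Rightarrow> (real^'n) set \<Rightarrow> (real^'n \<Rightarrow> real) \<Rightarrow> bool" where
  "ck_on 0 S F \<longleftrightarrow> continuous_on S F"
| "ck_on (Suc k) S F \<longleftrightarrow> (\<forall>x\<in>S. F differentiable (at x)) \<and> (\<forall>i. ck_on k S (partial i F))"

definition smooth_on :: "(real^'n) set \<Rightarrow> (real^'n \<Rightarrow> real) \<Rightarrow> bool" where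
  "smooth_on S F \<longleftrightarrow> (\<forall>k. ck_on k S F)"


section \<open>Smooth manifolds\<close>

text \<open>A chart is a pair of a domain and a coordinate map; the coordinate map is only meaningful
  on the domain. The dimension of the manifold is \<open>CARD('n)\<close>.\<close>

type_synonym ('a, 'n) chart = "'a set \<times> ('a \<Rightarrow> real^'n)"

abbreviation dom_chart :: "('a, 'n::finite) chart \<Rightarrow> 'a set" where
  "dom_chart c \<equiv> fst c"

abbreviation coords :: "('a, 'n::finite) chart \<Rightarrow> 'a \<Rightarrow> real^'n" where
  "coords c \<equiv> snd c"

definition inv_chart :: "('a, 'n::finite) chart \<Rightarrow> real^'n \<Rightarrow> 'a" where
  "inv_chart c = inv_into (dom_chart c) (coords c)"

definition is_chart :: "'a topology \<Rightarrow> ('a, 'n::finite) chart \<Rightarrow> bool" where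
  "is_chart X c \<longleftrightarrow> openin X (dom_chart c) \<and> open (coords c ` dom_chart c) \<and>
     homeomorphic_map (subtopology X (dom_chart c)) (top_of_set (coords c ` dom_chart c)) (coords c)"

definition transition :: "('a, 'n::finite) chart \<Rightarrow> ('a, 'n) chart \<Rightarrow> real^'n \<Rightarrow> real^'n" where
  "transition c c' = coords c' \<circ> inv_chart c"

definition smooth_transition :: "('a, 'n::finite) chart \<Rightarrow> ('a, 'n) chart \<Rightarrow> bool" where
  "smooth_transition c c' \<longleftrightarrow>
     (\<forall>i. smooth_on (coords c ` (dom_chart c \<inter> dom_chart c')) (\<lambda>x. transition c c' x $ i))"

text \<open>A smooth structure is a maximal smooth atlas, so that its elements are all the local
  coordinate systems of the manifold.\<close>

definition smooth_structure :: "'a topology \<Rightarrow> ('a, 'n::finite) chart set \<Rightarrow> bool" where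
  "smooth_structure X A \<longleftrightarrow>
     (\<forall>c\<in>A. is_chart X c) \<and> (\<Union>c\<in>A. dom_chart c) = topspace X \<and>
     (\<forall>c\<in>A. \<forall>c'\<in>A. smooth_transition c c') \<and>
     (\<forall>c. is_chart X c \<and> (\<forall>c'\<in>A. smooth_transition c c' \<and> smooth_transition c' c) \<longrightarrow> c \<in> A)"

definition connected_manifold :: "'a topology \<Rightarrow> ('a, 'n::finite) chart set \<Rightarrow> bool" where
  "connected_manifold X A \<longleftrightarrow>
     Hausdorff_space X \<and> second_countable X \<and> connected_space X \<and> topspace X \<noteq> {} \<and>
     smooth_structure X A"

definition smooth_fun_on :: "('a, 'n::finite) chart set \<Rightarrow> 'a set \<Rightarrow> ('a \<Rightarrow> real) \<Rightarrow> bool" where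
  "smooth_fun_on A W f \<longleftrightarrow>
     (\<forall>c\<in>A. smooth_on (coords c ` (dom_chart c \<inter> W)) (f \<circ> inv_chart c))"

definition test_function :: "'a topology \<Rightarrow> ('a, 'n::finite) chart set \<Rightarrow> ('a \<Rightarrow> real) \<Rightarrow> bool" where
  "test_function X A f \<longleftrightarrow> smooth_fun_on A (topspace X) f \<and>
     compactin X (X closure_of {x \<in> topspace X. f x \<noteq> 0})"

text \<open>\<open>pd c i f\<close> is the derivative of \<open>f\<close> along the \<open>i\<close>-th coordinate of the chart \<open>c\<close>.\<close>

definition pd :: "('a, 'n::finite) chart \<Rightarrow> 'n \<Rightarrow> ('a \<Rightarrow> real) \<Rightarrow> 'a \<Rightarrow> real" where
  "pd c i f q = partial i (f \<circ> inv_chart c) (coords c q)"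


section \<open>Tangent and cotangent spaces\<close>

text \<open>A tangent vector is the family of its component vectors in all charts at the base point,
  subject to the usual transformation law. The following type only provides the ambient vector
  space of all such families.\<close>

typedef ('a, 'n::finite) tvec = "UNIV :: (('a, 'n) chart \<Rightarrow> real^'n) set"
  morphisms comp Tvec by simp

instantiation tvec :: (type, finite) real_vector
begin

definition "0 = Tvec (\<lambda>c. 0)"
definition "u + v = Tvec (\<lambda>c. comp u c + comp v c)"
definition "u - v = Tvec (\<lambda>c. comp u c - comp v c)"
definition "- v = Tvec (\<lambda>c. - comp v c)"
definition "a *\<^sub>R v = Tvec (\<lambda>c. a *\<^sub>R comp v c)"

instance
  by standard
    (simp_all add: zero_tvec_def plus_tvec_def minus_tvec_def uminus_tvec_def scaleR_tvec_def
      Tvec_inverse Tvec_inject comp_inverse algebra_simps)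

end

definition tangent :: "('a, 'n::finite) chart set \<Rightarrow> 'a \<Rightarrow> ('a, 'n) tvec set" where
  "tangent A q = {v.
     (\<forall>c. \<not> (c \<in> A \<and> q \<in> dom_chart c) \<longrightarrow> comp v c = 0) \<and>
     (\<forall>c\<in>A. \<forall>c'\<in>A. q \<in> dom_chart c \<inter> dom_chart c' \<longrightarrow>
        comp v c' = frechet_derivative (transition c c') (at (coords c q)) (comp v c))}"

text \<open>The coordinate vector \<open>\<partial>/\<partial>x\<^sup>i\<close> at \<open>q\<close>.\<close>

definition coord_vec :: "('a, 'n::finite) chart set \<Rightarrow> ('a, 'n) chart \<Rightarrow> 'n \<Rightarrow> 'a \<Rightarrow> ('a, 'n) tvec" where
  "coord_vec A c i q = Tvec (\<lambda>c'. if c' \<in> A \<and> q \<in> dom_chart c'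
     then frechet_derivative (transition c c') (at (coords c q)) (axis i 1) else 0)"

text \<open>Covectors at \<open>q\<close> are the linear functionals on the tangent space, extended by zero to the
  ambient type. Points of the cotangent bundle are pairs \<open>(q, p)\<close>.\<close>

type_synonym ('a, 'n) covec = "('a, 'n) tvec \<Rightarrow> real"

definition cotangent :: "('a, 'n::finite) chart set \<Rightarrow> 'a \<Rightarrow> ('a, 'n) covec set" where
  "cotangent A q = {p.
     (\<forall>u\<in>tangent A q. \<forall>v\<in>tangent A q. p (u + v) = p u + p v) \<and>
     (\<forall>a. \<forall>v\<in>tangent A q. p (a *\<^sub>R v) = a * p v) \<and>
     (\<forall>v. v \<notin> tangent A q \<longrightarrow> p v = 0)}"

text \<open>The covector with coordinates \<open>\<xi>\<close>, and the coordinate covector \<open>dx\<^sup>i\<close>.\<close>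

definition covec_of ::
  "('a, 'n::finite) chart set \<Rightarrow> ('a, 'n) chart \<Rightarrow> 'a \<Rightarrow> real^'n \<Rightarrow> ('a, 'n) covec" where
  "covec_of A c q \<xi> = (\<lambda>v. if v \<in> tangent A q then \<Sum>i\<in>UNIV. \<xi> $ i * comp v c $ i else 0)"

definition dx :: "('a, 'n::finite) chart set \<Rightarrow> ('a, 'n) chart \<Rightarrow> 'n \<Rightarrow> 'a \<Rightarrow> ('a, 'n) covec" where
  "dx A c i q = covec_of A c q (axis i 1)"

definition differential ::
  "('a, 'n::finite) chart set \<Rightarrow> ('a, 'n) chart \<Rightarrow> ('a \<Rightarrow> real) \<Rightarrow> 'a \<Rightarrow> ('a, 'n) covec" where
  "differential A c f q = covec_of A c q (\<chi> i. pd c i f q)"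

definition smooth_field_on ::
  "('a, 'n::finite) chart set \<Rightarrow> 'a set \<Rightarrow> ('a \<Rightarrow> ('a, 'n) tvec) \<Rightarrow> bool" where
  "smooth_field_on A W Y \<longleftrightarrow> (\<forall>q\<in>W. Y q \<in> tangent A q) \<and>
     (\<forall>c\<in>A. \<forall>i. smooth_on (coords c ` (dom_chart c \<inter> W)) (\<lambda>x. comp (Y (inv_chart c x)) c $ i))"


section \<open>Sub-Riemannian manifolds\<close>

text \<open>A smooth sub-bundle of rank \<open>m\<close> is given by its fibres and has smooth local frames.\<close>

definition smooth_subbundle ::
  "'a topology \<Rightarrow> ('a, 'n::finite) chart set \<Rightarrow> ('a \<Rightarrow> ('a, 'n) tvec set) \<Rightarrow> nat \<Rightarrow> bool" where
  "smooth_subbundle X A H m \<longleftrightarrow>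
     (\<forall>q\<in>topspace X. subspace (H q) \<and> H q \<subseteq> tangent A q \<and> dim (H q) = m) \<and>
     (\<forall>q\<in>topspace X. \<exists>W Y. openin X W \<and> q \<in> W \<and>
        (\<forall>j<m. smooth_field_on A W (Y j)) \<and> (\<forall>q'\<in>W. span ((\<lambda>j. Y j q') ` {..<m}) = H q'))"

type_synonym ('a, 'n) metric = "'a \<Rightarrow> ('a, 'n) tvec \<Rightarrow> ('a, 'n) tvec \<Rightarrow> real"

text \<open>Smoothly varying inner products on the fibres \<open>H q\<close>; values outside the fibres are
  irrelevant.\<close>

definition smooth_fibre_metric ::
  "'a topology \<Rightarrow> ('a, 'n::finite) chart set \<Rightarrow> ('a \<Rightarrow> ('a, 'n) tvec set) \<Rightarrow> ('a, 'n) metric \<Rightarrow> bool" where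
  "smooth_fibre_metric X A H G \<longleftrightarrow>
     (\<forall>q\<in>topspace X. \<forall>u\<in>H q. \<forall>v\<in>H q. G q u v = G q v u) \<and>
     (\<forall>q\<in>topspace X. \<forall>u\<in>H q. \<forall>v\<in>H q. \<forall>w\<in>H q. G q (u + v) w = G q u w + G q v w) \<and>
     (\<forall>q\<in>topspace X. \<forall>a. \<forall>u\<in>H q. \<forall>v\<in>H q. G q (a *\<^sub>R u) v = a * G q u v) \<and>
     (\<forall>q\<in>topspace X. \<forall>u\<in>H q. u \<noteq> 0 \<longrightarrow> G q u u > 0) \<and>
     (\<forall>W Y Z. openin X W \<and> smooth_field_on A W Y \<and> smooth_field_on A W Z \<and>
        (\<forall>q\<in>W. Y q \<in> H q \<and> Z q \<in> H q) \<longrightarrow> smooth_fun_on A W (\<lambda>q. G q (Y q) (Z q)))"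

definition sub_riemannian_manifold ::
  "'a topology \<Rightarrow> ('a, 'n::finite) chart set \<Rightarrow> ('a \<Rightarrow> ('a, 'n) tvec set) \<Rightarrow> ('a, 'n) metric
    \<Rightarrow> nat \<Rightarrow> bool" where
  "sub_riemannian_manifold X A H G m \<longleftrightarrow>
     connected_manifold X A \<and> smooth_subbundle X A H m \<and> smooth_fibre_metric X A H G"

definition riemannian_metric ::
  "'a topology \<Rightarrow> ('a, 'n::finite) chart set \<Rightarrow> ('a, 'n) metric \<Rightarrow> bool" where
  "riemannian_metric X A g \<longleftrightarrow> smooth_fibre_metric X A (tangent A) g"

definition compatible_metric ::
  "'a topology \<Rightarrow> ('a, 'n::finite) chart set \<Rightarrow> ('a \<Rightarrow> ('a, 'n) tvec set) \<Rightarrow> ('a, 'n) metric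
    \<Rightarrow> ('a, 'n) metric \<Rightarrow> bool" where
  "compatible_metric X A H G g \<longleftrightarrow> riemannian_metric X A g \<and>
     (\<forall>q\<in>topspace X. \<forall>u\<in>H q. \<forall>v\<in>H q. g q u v = G q u v)"

text \<open>The bundle map \<open>v \<mapsto> g(\<cdot>, v)\<close> from the tangent to the cotangent bundle.\<close>

definition flat ::
  "('a, 'n::finite) chart set \<Rightarrow> ('a, 'n) metric \<Rightarrow> 'a \<Rightarrow> ('a, 'n) tvec \<Rightarrow> ('a, 'n) covec" where
  "flat A g q v = (\<lambda>u. if u \<in> tangent A q then g q u v else 0)"

definition beta ::
  "('a \<Rightarrow> ('a, 'n::finite) tvec set) \<Rightarrow> ('a, 'n) metric \<Rightarrow> 'a \<Rightarrow> ('a, 'n) covec \<Rightarrow> ('a, 'n) tvec" where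
  "beta H G q p = (THE u. u \<in> H q \<and> (\<forall>v\<in>H q. G q u v = p v))"

definition hamiltonian ::
  "('a \<Rightarrow> ('a, 'n::finite) tvec set) \<Rightarrow> ('a, 'n) metric \<Rightarrow> 'a \<times> ('a, 'n) covec \<Rightarrow> real" where
  "hamiltonian H G z =
     1/2 * G (fst z) (beta H G (fst z) (snd z)) (beta H G (fst z) (snd z))"


section \<open>The Hamiltonian flow\<close>

text \<open>The Hamiltonian as a function of the canonical coordinates \<open>(x, \<xi>)\<close> induced by \<open>c\<close>.\<close>

definition hamiltonian_coords ::
  "('a, 'n::finite) chart set \<Rightarrow> ('a \<Rightarrow> ('a, 'n) tvec set) \<Rightarrow> ('a, 'n) metric \<Rightarrow> ('a, 'n) chart
    \<Rightarrow> real^'n \<Rightarrow> real^'n \<Rightarrow> real" where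
  "hamiltonian_coords A H G c x \<xi> =
     hamiltonian H G (inv_chart c x, covec_of A c (inv_chart c x) \<xi>)"

definition momenta ::
  "('a, 'n::finite) chart set \<Rightarrow> ('a, 'n) chart \<Rightarrow> 'a \<times> ('a, 'n) covec \<Rightarrow> real^'n" where
  "momenta A c z = (\<chi> i. snd z (coord_vec A c i (fst z)))"

definition hamiltonian_curve_on ::
  "'a topology \<Rightarrow> ('a, 'n::finite) chart set \<Rightarrow> ('a \<Rightarrow> ('a, 'n) tvec set) \<Rightarrow> ('a, 'n) metric
    \<Rightarrow> real set \<Rightarrow> (real \<Rightarrow> 'a \<times> ('a, 'n) covec) \<Rightarrow> bool" where
  "hamiltonian_curve_on X A H G I \<gamma> \<longleftrightarrow>
     continuous_map (top_of_set I) X (\<lambda>t. fst (\<gamma> t)) \<and>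
     (\<forall>t\<in>I. snd (\<gamma> t) \<in> cotangent A (fst (\<gamma> t))) \<and>
     (\<forall>t\<in>I. \<forall>c\<in>A. fst (\<gamma> t) \<in> dom_chart c \<longrightarrow>
        (let x = coords c (fst (\<gamma> t)); \<xi> = momenta A c (\<gamma> t) in
          \<forall>i. ((\<lambda>s. coords c (fst (\<gamma> s)) $ i) has_real_derivative
                  partial i (\<lambda>\<eta>. hamiltonian_coords A H G c x \<eta>) \<xi>) (at t) \<and>
              ((\<lambda>s. momenta A c (\<gamma> s) $ i) has_real_derivative
                  - partial i (\<lambda>y. hamiltonian_coords A H G c y \<xi>) x) (at t)))"

text \<open>By uniqueness for ordinary differential equations, any \<open>\<Phi>\<close> as below agrees for small
  times with the maximal flow.\<close>

definition hamiltonian_flow ::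
  "'a topology \<Rightarrow> ('a, 'n::finite) chart set \<Rightarrow> ('a \<Rightarrow> ('a, 'n) tvec set) \<Rightarrow> ('a, 'n) metric
    \<Rightarrow> (real \<Rightarrow> 'a \<times> ('a, 'n) covec \<Rightarrow> 'a \<times> ('a, 'n) covec) \<Rightarrow> bool" where
  "hamiltonian_flow X A H G \<Phi> \<longleftrightarrow>
     (\<forall>q\<in>topspace X. \<forall>p\<in>cotangent A q.
        \<Phi> 0 (q, p) = (q, p) \<and>
        (\<exists>e>0. hamiltonian_curve_on X A H G {-e<..<e} (\<lambda>t. \<Phi> t (q, p))))"


section \<open>The horizontal sub-Laplacian\<close>

definition horizontal_sphere ::
  "('a \<Rightarrow> ('a, 'n::finite) tvec set) \<Rightarrow> ('a, 'n) metric \<Rightarrow> 'a \<Rightarrow> ('a, 'n) tvec set" where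
  "horizontal_sphere H G x = {v \<in> H x. G x v v = 1}"

definition open_in_sphere ::
  "('a \<Rightarrow> ('a, 'n::finite) tvec set) \<Rightarrow> ('a, 'n) metric \<Rightarrow> 'a \<Rightarrow> ('a, 'n) tvec set \<Rightarrow> bool" where
  "open_in_sphere H G x B \<longleftrightarrow> B \<subseteq> horizontal_sphere H G x \<and>
     (\<forall>v\<in>B. \<exists>e>0. \<forall>w\<in>horizontal_sphere H G x. sqrt (G x (w - v) (w - v)) < e \<longrightarrow> w \<in> B)"

definition fibre_isometry ::
  "('a \<Rightarrow> ('a, 'n::finite) tvec set) \<Rightarrow> ('a, 'n) metric \<Rightarrow> 'a
    \<Rightarrow> (('a, 'n) tvec \<Rightarrow> ('a, 'n) tvec) \<Rightarrow> bool" where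
  "fibre_isometry H G x R \<longleftrightarrow> R ` H x = H x \<and>
     (\<forall>u\<in>H x. \<forall>v\<in>H x. R (u + v) = R u + R v) \<and>
     (\<forall>a. \<forall>v\<in>H x. R (a *\<^sub>R v) = a *\<^sub>R R v) \<and>
     (\<forall>u\<in>H x. \<forall>v\<in>H x. G x (R u) (R v) = G x u v)"

text \<open>Invariance is required under the full orthogonal group of the fibre; for fibres of dimension
  one, invariance under the special orthogonal group would not determine the measure.\<close>

definition rotation_invariant_probability ::
  "('a \<Rightarrow> ('a, 'n::finite) tvec set) \<Rightarrow> ('a, 'n) metric \<Rightarrow> 'a \<Rightarrow> ('a, 'n) tvec measure \<Rightarrow> bool" where
  "rotation_invariant_probability H G x \<mu> \<longleftrightarrow>
     space \<mu> = horizontal_sphere H G x \<and>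
     sets \<mu> = sigma_sets (horizontal_sphere H G x) {B. open_in_sphere H G x B} \<and>
     emeasure \<mu> (space \<mu>) = 1 \<and>
     (\<forall>R. fibre_isometry H G x R \<longrightarrow>
        (\<forall>B\<in>sets \<mu>. emeasure \<mu> (R -` B \<inter> space \<mu>) = emeasure \<mu> B))"

definition horizontal_sub_laplacian ::
  "('a, 'n::finite) chart set \<Rightarrow> ('a, 'n) metric
    \<Rightarrow> (real \<Rightarrow> 'a \<times> ('a, 'n) covec \<Rightarrow> 'a \<times> ('a, 'n) covec)
    \<Rightarrow> ('a \<Rightarrow> ('a, 'n) tvec measure) \<Rightarrow> ('a \<Rightarrow> real) \<Rightarrow> 'a \<Rightarrow> real" where
  "horizontal_sub_laplacian A g \<Phi> U f x =
     (\<integral>v. deriv (\<lambda>t. deriv (\<lambda>s. f (fst (\<Phi> (t + s) (x, flat A g x v)))) 0) 0 \<partial>(U x))"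


section \<open>Local expressions\<close>

definition beta_coeff ::
  "('a, 'n::finite) chart set \<Rightarrow> ('a \<Rightarrow> ('a, 'n) tvec set) \<Rightarrow> ('a, 'n) metric \<Rightarrow> ('a, 'n) chart
    \<Rightarrow> 'n \<Rightarrow> 'n \<Rightarrow> 'a \<Rightarrow> real" where
  "beta_coeff A H G c i j q = G q (beta H G q (dx A c i q)) (beta H G q (dx A c j q))"

definition metric_coeff ::
  "('a, 'n::finite) chart set \<Rightarrow> ('a, 'n) metric \<Rightarrow> ('a, 'n) chart \<Rightarrow> 'n \<Rightarrow> 'n \<Rightarrow> 'a \<Rightarrow> real" where
  "metric_coeff A g c i j q = g q (coord_vec A c i q) (coord_vec A c j q)"

definition Gamma_coeff ::
  "('a, 'n::finite) chart set \<Rightarrow> ('a \<Rightarrow> ('a, 'n) tvec set) \<Rightarrow> ('a, 'n) metric \<Rightarrow> ('a, 'n) chart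
    \<Rightarrow> 'n \<Rightarrow> 'n \<Rightarrow> 'n \<Rightarrow> 'a \<Rightarrow> real" where
  "Gamma_coeff A H G c i j k q = - 1/2 * (\<Sum>l\<in>UNIV.
       beta_coeff A H G c i l q * pd c l (beta_coeff A H G c j k) q
     + beta_coeff A H G c j l q * pd c l (beta_coeff A H G c i k) q
     - beta_coeff A H G c l k q * pd c l (beta_coeff A H G c i j) q)"

text \<open>The Laplace-Beltrami operator is the divergence of the gradient, where the divergence with
  respect to the Riemannian volume is \<open>1/\<surd>det g \<Sum>\<^sub>i \<partial>\<^sub>i (\<surd>det g Y\<^sup>i)\<close> in any chart.\<close>

definition gradient ::
  "('a, 'n::finite) chart set \<Rightarrow> ('a, 'n) metric \<Rightarrow> ('a, 'n) chart \<Rightarrow> ('a \<Rightarrow> real) \<Rightarrow> 'a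
    \<Rightarrow> ('a, 'n) tvec" where
  "gradient A g c f q =
     (THE u. u \<in> tangent A q \<and> (\<forall>v\<in>tangent A q. g q u v = differential A c f q v))"

definition volume_density ::
  "('a, 'n::finite) chart set \<Rightarrow> ('a, 'n) metric \<Rightarrow> ('a, 'n) chart \<Rightarrow> 'a \<Rightarrow> real" where
  "volume_density A g c q = sqrt (det (\<chi> i j. metric_coeff A g c i j q))"

definition divergence ::
  "('a, 'n::finite) chart set \<Rightarrow> ('a, 'n) metric \<Rightarrow> ('a, 'n) chart \<Rightarrow> ('a \<Rightarrow> ('a, 'n) tvec)
    \<Rightarrow> 'a \<Rightarrow> real" where
  "divergence A g c Y q =
     (\<Sum>i\<in>UNIV. pd c i (\<lambda>q'. volume_density A g c q' * comp (Y q') c $ i) q) / volume_density A g c q"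

definition laplace_beltrami ::
  "('a, 'n::finite) chart set \<Rightarrow> ('a, 'n) metric \<Rightarrow> ('a, 'n) chart \<Rightarrow> ('a \<Rightarrow> real) \<Rightarrow> 'a \<Rightarrow> real" where
  "laplace_beltrami A g c f = divergence A g c (gradient A g c f)"

end

theory Submission
  imports Defs
begin

text \<open>In canonical coordinates the Hamiltonian is \<open>1/2 \<beta>\<^sup>i\<^sup>j \<xi>\<^sub>i \<xi>\<^sub>j\<close> with \<open>\<beta>\<close> the inverse of the Gram matrix of
  the metric, so the second derivative of \<open>f\<close> along the curve starting at \<open>g(\<cdot>, v)\<close> is a quadratic form
  in \<open>v\<close>. Reflections of the fibre show that \<open>\<integral> \<langle>v, a\<rangle> \<langle>v, b\<rangle> \<partial>U\<close> is a multiple of \<open>\<langle>a, b\<rangle>\<close>, and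
  \<open>\<langle>v, v\<rangle> = 1\<close> identifies the factor as \<open>1/m\<close>; averaging therefore contracts the quadratic form with
  the metric. For the Laplace-Beltrami operator, Jacobi's formula and the derivative of
  \<open>\<beta>\<^sup>a\<^sup>b g\<^sub>b\<^sub>a = m\<close> turn the logarithmic derivative of the volume density into
  \<open>- 1/2 g\<^sub>a\<^sub>b \<partial>\<^sub>i \<beta>\<^sup>a\<^sup>b\<close>, which leads to the same expression.\<close>

section \<open>Calculus with partial derivatives\<close>

text \<open>The operators are total, so a derivative that fails to exist still has a value; the
  derivatives in the statement must therefore be backed by proofs of differentiability. For the
  metric this information is available only through smooth vector fields, so the coordinate fields
  first have to be shown smooth in every chart of the atlas, which is what the chain rule for
  \<open>ck_on\<close> is for. The inverse matrix inherits differentiability by Cramer's rule, and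
  one derivative is enough, because no second derivative of the metric occurs. One reflection
  exchanges any two distinct vectors of equal length, so square moments depend on length alone, and
  polarization handles mixed moments. The factor 1/m is found without an orthonormal basis: the
  coordinate vectors and the images under \<open>beta\<close> of the coordinate covectors are dual
  frames, so the moments summed over them give <v, v> on one side and the dimension on the
  other.\<close>

lemma sum_axis [simp]: "(\<Sum>j\<in>UNIV. axis i (1::real) $ j * f j) = f i"
  by (simp add: axis_def if_distrib[of "\<lambda>y. y * _"] cong: if_cong)

text \<open>\<open>partial\<close> is a \<open>deriv\<close> along a line and by itself carries no
  differentiability. Through this bridge the rules for total derivatives become rules for
  \<open>partial\<close>.\<close>

lemma partial_eq_derivative:
  assumes "(F has_derivative D) (at x)"
  shows "partial i F x = D (axis i 1)"
proof -
  have "((\<lambda>t. x + t *\<^sub>R axis i 1) has_derivative (\<lambda>t. t *\<^sub>R axis i 1)) (at 0)"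
    by (auto intro!: derivative_eq_intros)
  moreover have "(F has_derivative D) (at (x + 0 *\<^sub>R axis i 1))"
    using assms by simp
  ultimately have "((\<lambda>t. F (x + t *\<^sub>R axis i 1)) has_derivative (\<lambda>t. D (t *\<^sub>R axis i 1))) (at 0)"
    by (rule has_derivative_compose)
  moreover have "D (t *\<^sub>R axis i 1) = D (axis i 1) * t" for t
    using has_derivative_linear[OF assms] by (simp add: linear_cmul)
  ultimately have "((\<lambda>t. F (x + t *\<^sub>R axis i 1)) has_field_derivative D (axis i 1)) (at 0)"
    unfolding has_field_derivative_def by simp
  then show ?thesis
    unfolding partial_def by (rule DERIV_imp_deriv)
qed

lemma has_derivative_partial:
  fixes F :: "real^'n \<Rightarrow> real"
  assumes "F differentiable (at x)"
  shows "(F has_derivative (\<lambda>v. \<Sum>i\<in>UNIV. v $ i * partial i F x)) (at x)"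
proof -
  obtain D where D: "(F has_derivative D) (at x)"
    using assms by (auto simp: differentiable_def)
  have lin: "linear D"
    using D by (rule has_derivative_linear)
  have "D v = (\<Sum>i\<in>UNIV. v $ i * partial i F x)" for v
  proof -
    have "D v = D (\<Sum>i\<in>UNIV. v $ i *\<^sub>R axis i 1)"
      by (metis (no_types, lifting) basis_expansion scalar_mult_eq_scaleR sum.cong)
    also have "\<dots> = (\<Sum>i\<in>UNIV. v $ i * D (axis i 1))"
      using lin by (simp add: linear_sum linear_cmul)
    finally show ?thesis
      using partial_eq_derivative[OF D] by simp
  qed
  then have "D = (\<lambda>v. \<Sum>i\<in>UNIV. v $ i * partial i F x)"
    by (rule ext)
  with D show ?thesis by simp
qed

lemma has_field_derivative_partial:
  fixes F :: "real^'n \<Rightarrow> real"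
  assumes "F differentiable (at x)"
  shows "((\<lambda>t. F (x + t *\<^sub>R axis i 1)) has_field_derivative partial i F x) (at 0)"
proof -
  have "((\<lambda>t. x + t *\<^sub>R axis i 1) has_derivative (\<lambda>t. t *\<^sub>R axis i 1)) (at 0)"
    by (auto intro!: derivative_eq_intros)
  moreover have "(F has_derivative (\<lambda>v. \<Sum>i\<in>UNIV. v $ i * partial i F x)) (at (x + 0 *\<^sub>R axis i 1))"
    using has_derivative_partial[OF assms] by simp
  ultimately have "((\<lambda>t. F (x + t *\<^sub>R axis i 1)) has_derivative
      (\<lambda>t. \<Sum>j\<in>UNIV. (t *\<^sub>R axis i 1) $ j * partial j F x)) (at 0)"
    by (rule has_derivative_compose)
  moreover have "(\<Sum>j\<in>UNIV. (t *\<^sub>R axis i 1) $ j * partial j F x) = partial i F x * t" for t :: real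
  proof -
    have "(\<Sum>j\<in>UNIV. (t *\<^sub>R axis i 1) $ j * partial j F x) =
        (\<Sum>j\<in>UNIV. if j = i then t * partial j F x else 0)"
      by (rule sum.cong) (auto simp: axis_def)
    then show ?thesis by simp
  qed
  ultimately show ?thesis
    unfolding has_field_derivative_def by simp
qed

section \<open>Locality of partial derivatives and closure properties of the C^k classes\<close>

lemma eventually_line_in_open:
  fixes x :: "real^'n"
  assumes "open S" "x \<in> S"
  shows "\<forall>\<^sub>F t in nhds 0. x + t *\<^sub>R axis i 1 \<in> S"
proof -
  have "open ((\<lambda>t::real. x + t *\<^sub>R axis i 1) -` S)"
    by (intro open_vimage assms continuous_intros)
  then show ?thesis
    using assms(2) by (auto simp: eventually_nhds)
qed

text \<open>Functions pulled back by \<open>inv_chart\<close> are controlled only on the image of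
  the chart, so identities between them hold on an open set and have to be differentiated
  locally.\<close>

lemma partial_cong:
  assumes "open S" "x \<in> S" "\<And>y. y \<in> S \<Longrightarrow> F y = F' y"
  shows "partial i F x = partial i F' x"
  unfolding partial_def
  by (rule deriv_cong_ev) (auto intro: eventually_mono[OF eventually_line_in_open[OF assms(1,2)]] assms(3))

lemma differentiable_cong_open:
  fixes F F' :: "real^'n \<Rightarrow> real"
  assumes "open S" "x \<in> S" "\<And>y. y \<in> S \<Longrightarrow> F y = F' y" "F differentiable (at x)"
  shows "F' differentiable (at x)"
  using assms has_derivative_transform_within_open[of F _ x UNIV S F']
  unfolding differentiable_def by blast

lemma ck_on_cong:
  assumes "open S" "\<And>x. x \<in> S \<Longrightarrow> F x = F' x" "ck_on k S F"
  shows "ck_on k S F'"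
  using assms(2,3)
proof (induction k arbitrary: F F')
  case 0
  then show ?case by (simp cong: continuous_on_cong)
next
  case (Suc k)
  have "F' differentiable (at x)" if "x \<in> S" for x
    using differentiable_cong_open[OF assms(1) that Suc.prems(1)] Suc.prems(2) that by simp
  moreover have "ck_on k S (partial i F')" for i
  proof (rule Suc.IH)
    show "partial i F x = partial i F' x" if "x \<in> S" for x
      using assms(1) that Suc.prems(1) by (rule partial_cong)
    show "ck_on k S (partial i F)"
      using Suc.prems(2) by simp
  qed
  ultimately show ?case by simp
qed

lemma ck_on_Suc_imp: "ck_on (Suc k) S F \<Longrightarrow> ck_on k S F"
proof (induction k arbitrary: F)
  case 0
  then show ?case
    by (auto intro!: differentiable_imp_continuous_on differentiable_at_imp_differentiable_on)
next
  case (Suc k)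
  then show ?case by (metis ck_on.simps(2))
qed

lemma partial_const: "partial i (\<lambda>x. c) = (\<lambda>x. 0)"
  by (simp add: partial_def fun_eq_iff)

lemma ck_on_const: "ck_on k S (\<lambda>x. c)"
  by (induction k arbitrary: c) (auto simp: partial_const)

lemma ck_on_add:
  assumes "open S" "ck_on k S F" "ck_on k S F'"
  shows "ck_on k S (\<lambda>x. F x + F' x)"
  using assms(2,3)
proof (induction k arbitrary: F F')
  case 0
  then show ?case by (simp add: continuous_on_add)
next
  case (Suc k)
  have eq: "partial i F x + partial i F' x = partial i (\<lambda>x. F x + F' x) x" if "x \<in> S" for i x
  proof -
    have "F differentiable (at x)" "F' differentiable (at x)"
      using Suc.prems that by simp_all
    note D = this[THEN has_derivative_partial]
    show ?thesis
      by (simp only: partial_eq_derivative[OF has_derivative_add[OF D]]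
          partial_eq_derivative[OF D(1), symmetric] partial_eq_derivative[OF D(2), symmetric])
  qed
  have ck: "ck_on k S (\<lambda>x. partial i F x + partial i F' x)" for i
    using Suc by simp
  have "ck_on k S (partial i (\<lambda>x. F x + F' x))" for i
    by (rule ck_on_cong[OF assms(1) eq ck])
  then show ?case using Suc.prems by (simp add: differentiable_add)
qed

lemma ck_on_mult:
  assumes "open S" "ck_on k S F" "ck_on k S F'"
  shows "ck_on k S (\<lambda>x. F x * F' x)"
  using assms(2,3)
proof (induction k arbitrary: F F')
  case 0
  then show ?case by (simp add: continuous_on_mult)
next
  case (Suc k)
  have eq: "F x * partial i F' x + partial i F x * F' x = partial i (\<lambda>x. F x * F' x) x" if "x \<in> S" for i x
  proof -
    have "F differentiable (at x)" "F' differentiable (at x)"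
      using Suc.prems that by simp_all
    note D = this[THEN has_derivative_partial]
    show ?thesis
      by (simp only: partial_eq_derivative[OF has_derivative_mult[OF D]]
          partial_eq_derivative[OF D(1), symmetric] partial_eq_derivative[OF D(2), symmetric])
  qed
  \<comment> \<open>The product rule multiplies a derivative of one factor by the other factor
    itself, which must be lowered from level \<open>Suc k\<close> to \<open>k\<close> before the
    induction hypothesis applies.\<close>
  have ck: "ck_on k S (\<lambda>x. F x * partial i F' x + partial i F x * F' x)" for i
    using Suc ck_on_Suc_imp[OF Suc.prems(1)] ck_on_Suc_imp[OF Suc.prems(2)]
    by (intro ck_on_add[OF assms(1)] Suc.IH) auto
  have "ck_on k S (partial i (\<lambda>x. F x * F' x))" for i
    by (rule ck_on_cong[OF assms(1) eq ck])
  then show ?case using Suc.prems by (simp add: differentiable_mult)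
qed

lemma ck_on_sum:
  assumes "open S" "\<And>j. j \<in> J \<Longrightarrow> ck_on k S (F j)"
  shows "ck_on k S (\<lambda>x. \<Sum>j\<in>J. F j x)"
  using assms(2) by (induction J rule: infinite_finite_induct) (simp_all add: ck_on_const ck_on_add[OF assms(1)])

lemma has_derivative_components:
  fixes f :: "'b::real_normed_vector \<Rightarrow> real^'n"
  shows "(f has_derivative f') (at x) \<longleftrightarrow> (\<forall>i. ((\<lambda>y. f y $ i) has_derivative (\<lambda>v. f' v $ i)) (at x))"
  by (simp add: has_derivative_componentwise_within[of f] Basis_vec_def inner_axis)

lemma partial_compose:
  fixes F :: "real^'n \<Rightarrow> real" and f :: "real^'m \<Rightarrow> real^'n"
  assumes "\<And>j. (\<lambda>y. f y $ j) differentiable (at x)" "F differentiable (at (f x))"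
  shows "(\<lambda>y. F (f y)) differentiable (at x)"
    and "partial i (\<lambda>y. F (f y)) x = (\<Sum>j\<in>UNIV. partial i (\<lambda>y. f y $ j) x * partial j F (f x))"
proof -
  have "(f has_derivative (\<lambda>v. \<chi> j. \<Sum>i\<in>UNIV. v $ i * partial i (\<lambda>y. f y $ j) x)) (at x)"
    by (simp add: has_derivative_components has_derivative_partial assms(1))
  from has_derivative_compose[OF this has_derivative_partial[OF assms(2)]]
  have D: "((\<lambda>y. F (f y)) has_derivative
      (\<lambda>v. \<Sum>j\<in>UNIV. (\<Sum>i\<in>UNIV. v $ i * partial i (\<lambda>y. f y $ j) x) * partial j F (f x))) (at x)"
    by simp
  then show "(\<lambda>y. F (f y)) differentiable (at x)"
    by (auto simp: differentiable_def)
  show "partial i (\<lambda>y. F (f y)) x = (\<Sum>j\<in>UNIV. partial i (\<lambda>y. f y $ j) x * partial j F (f x))"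
    by (simp add: partial_eq_derivative[OF D])
qed

text \<open>Needed for changes of chart: the components of a coordinate field in a second chart are
  derivatives of one transition map composed with the inverse transition. In the induction
  \<open>f\<close> stays fixed while \<open>F\<close> is replaced by its partial
  derivatives.\<close>

lemma ck_on_compose:
  fixes F :: "real^'n \<Rightarrow> real" and f :: "real^'m \<Rightarrow> real^'n"
  assumes "open S" "\<And>x. x \<in> S \<Longrightarrow> f x \<in> T" "\<And>j. ck_on k S (\<lambda>x. f x $ j)" "ck_on k T F"
  shows "ck_on k S (\<lambda>x. F (f x))"
  using assms(3,4)
proof (induction k arbitrary: F)
  case 0
  then have "continuous_on S (\<lambda>x. \<chi> j. f x $ j)"
    by (intro continuous_on_vec_lambda) auto
  with 0 show ?case
    using assms(2) by (auto intro: continuous_on_compose2[of T])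
next
  case (Suc k)
  have "ck_on k S (\<lambda>x. partial j F (f x))" for j
    by (rule Suc.IH) (use Suc.prems in \<open>auto intro: ck_on_Suc_imp simp del: ck_on.simps simp: ck_on.simps(2)[of k T]\<close>)
  then have ck: "ck_on k S (\<lambda>x. \<Sum>j\<in>UNIV. partial i (\<lambda>y. f y $ j) x * partial j F (f x))" for i
    using Suc.prems by (intro ck_on_sum ck_on_mult assms(1)) auto
  have eq: "(\<Sum>j\<in>UNIV. partial i (\<lambda>y. f y $ j) x * partial j F (f x)) = partial i (\<lambda>y. F (f y)) x"
    if "x \<in> S" for i x
    by (rule partial_compose(2)[symmetric]) (use Suc.prems assms(2) that in simp_all)
  have "ck_on k S (partial i (\<lambda>y. F (f y)))" for i
    by (rule ck_on_cong[OF assms(1) eq ck])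
  then show ?case
    using Suc.prems assms(2) by (simp add: partial_compose(1))
qed

lemma smooth_on_cong: "open S \<Longrightarrow> (\<And>x. x \<in> S \<Longrightarrow> F x = F' x) \<Longrightarrow> smooth_on S F \<Longrightarrow> smooth_on S F'"
  unfolding smooth_on_def by (meson ck_on_cong)

lemma smooth_on_compose:
  fixes F :: "real^'n \<Rightarrow> real" and f :: "real^'m \<Rightarrow> real^'n"
  assumes "open S" "\<And>x. x \<in> S \<Longrightarrow> f x \<in> T" "\<And>j. smooth_on S (\<lambda>x. f x $ j)" "smooth_on T F"
  shows "smooth_on S (\<lambda>x. F (f x))"
  using assms(3,4) ck_on_compose[of S f T, OF assms(1,2)] unfolding smooth_on_def by blast

lemma smooth_on_differentiable: "smooth_on S F \<Longrightarrow> x \<in> S \<Longrightarrow> F differentiable (at x)"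
  unfolding smooth_on_def by (metis ck_on.simps(2))

lemma smooth_on_partial: "smooth_on S F \<Longrightarrow> smooth_on S (partial i F)"
  unfolding smooth_on_def by (metis ck_on.simps(2))


section \<open>Derivatives of determinants and inverse matrices\<close>

text \<open>In the Leibniz formula at the identity, a permutation other than \<open>id\<close> moves
  at least two points, so after one factor is differentiated a vanishing off-diagonal entry remains.
  Only the diagonal product contributes, and it gives the trace.\<close>

lemma has_field_derivative_det_identity:
  fixes M :: "real \<Rightarrow> real^'n^'n"
  assumes M: "\<And>i j. ((\<lambda>t. M t $ i $ j) has_field_derivative M' $ i $ j) (at 0)" and one: "M 0 = mat 1"
  shows "((\<lambda>t. det (M t)) has_field_derivative trace M') (at 0)"
proof -
  have prod: "((\<lambda>t. \<Prod>i\<in>UNIV. M t $ i $ p i) has_derivative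
      (\<lambda>y. \<Sum>i\<in>UNIV. (M' $ i $ p i * y) * (\<Prod>j\<in>UNIV - {i}. M 0 $ j $ p j))) (at 0)" for p
    by (rule has_derivative_prod) (use M in \<open>auto simp: has_field_derivative_def\<close>)
  have only_id: "(\<Prod>j\<in>UNIV - {i}. M 0 $ j $ p j) = (if p = id then 1 else 0)"
    if p: "p permutes UNIV" for p :: "'n \<Rightarrow> 'n" and i
  proof (cases "p = id")
    case False
    have "\<exists>j. j \<noteq> i \<and> p j \<noteq> j"
    proof (rule ccontr)
      assume "\<not> ?thesis"
      then have fix_: "p j = j" if "j \<noteq> i" for j using that by blast
      have "p i = i"
        using fix_ p by (metis permutes_inj injD)
      with fix_ have "p = id" by (metis eq_id_iff)
      then show False using False by simp
    qed
    then obtain j where j: "j \<noteq> i" "p j \<noteq> j" by blast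
    then have "M 0 $ j $ p j = 0"
      by (simp add: one mat_def)
    with j show ?thesis using False by (metis DiffI UNIV_I empty_iff finite insert_iff prod_zero)
  qed (simp add: one mat_def)
  have "((\<lambda>t. det (M t)) has_derivative (\<lambda>y. \<Sum>p | p permutes (UNIV::'n set). of_int (sign p) *
      (\<Sum>i\<in>UNIV. (M' $ i $ p i * y) * (\<Prod>j\<in>UNIV - {i}. M 0 $ j $ p j)))) (at 0)"
    unfolding det_def by (intro has_derivative_sum has_derivative_mult_right prod)
  moreover have "(\<Sum>p | p permutes (UNIV::'n set). of_int (sign p) *
      (\<Sum>i\<in>UNIV. (M' $ i $ p i * y) * (\<Prod>j\<in>UNIV - {i}. M 0 $ j $ p j))) = trace M' * y" for y
  proof -
    have "(\<Sum>p | p permutes (UNIV::'n set). of_int (sign p) *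
        (\<Sum>i\<in>UNIV. (M' $ i $ p i * y) * (\<Prod>j\<in>UNIV - {i}. M 0 $ j $ p j))) =
        (\<Sum>p | p permutes (UNIV::'n set). if p = id then trace M' * y else 0)"
      by (rule sum.cong) (auto simp: only_id trace_def sign_id sum_distrib_right)
    also have "\<dots> = trace M' * y"
      by (simp add: permutes_id finite_permutations)
    finally show ?thesis .
  qed
  ultimately show ?thesis
    unfolding has_field_derivative_def by simp
qed

text \<open>Multiplication by the left inverse of \<open>M 0\<close> moves the base point to the
  identity; multiplicativity of \<open>det\<close> restores the factor
  \<open>det (M 0)\<close>.\<close>

lemma has_field_derivative_det:
  fixes M :: "real \<Rightarrow> real^'n^'n"
  assumes M: "\<And>i j. ((\<lambda>t. M t $ i $ j) has_field_derivative M' $ i $ j) (at 0)"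
    and inv: "B ** M 0 = mat 1"
  shows "((\<lambda>t. det (M t)) has_field_derivative det (M 0) * trace (B ** M')) (at 0)"
proof -
  have "((\<lambda>t. (B ** M t) $ i $ j) has_field_derivative (B ** M') $ i $ j) (at 0)" for i j
    unfolding matrix_matrix_mult_def by (auto intro!: derivative_eq_intros M sum.cong)
  then have "((\<lambda>t. det (B ** M t)) has_field_derivative trace (B ** M')) (at 0)"
    using inv by (rule has_field_derivative_det_identity)
  then have "((\<lambda>t. det (M 0) * det (B ** M t)) has_field_derivative det (M 0) * trace (B ** M')) (at 0)"
    by (rule DERIV_cmult)
  moreover have "det (M 0) * det (B ** M t) = det (M t)" for t
  proof -
    have "det (M 0) * det B = 1"
      using inv by (metis det_I det_mul mult.commute)
    then show ?thesis by (simp add: det_mul flip: mult.assoc)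
  qed
  ultimately show ?thesis by simp
qed

text \<open>No positivity is needed, since \<open>sqrt\<close> is extended to an odd function on the negative reals.\<close>

lemma has_field_derivative_sqrt_det:
  fixes M :: "real \<Rightarrow> real^'n^'n"
  assumes M: "\<And>i j. ((\<lambda>t. M t $ i $ j) has_field_derivative M' $ i $ j) (at 0)"
    and inv: "B ** M 0 = mat 1"
  shows "((\<lambda>t. sqrt (det (M t))) has_field_derivative sqrt (det (M 0)) * (trace (B ** M') / 2)) (at 0)"
proof -
  let ?d = "det (M 0)"
  have nz: "?d \<noteq> 0"
    using inv by (metis det_I det_mul mult_zero_right zero_neq_one)
  \<comment> \<open>One expression covers both signs of the determinant. It keeps the factor
    \<open>sqrt ?d\<close>, which later cancels against the density in the divergence.\<close>
  have "(sqrt has_field_derivative sqrt ?d / (2 * ?d)) (at ?d)"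
  proof (rule DERIV_real_sqrt_generic[OF nz])
    assume "0 < ?d"
    then show "sqrt ?d / (2 * ?d) = inverse (sqrt ?d) / 2"
      by (simp add: field_simps flip: power2_eq_square)
  next
    assume "?d < 0"
    then show "sqrt ?d / (2 * ?d) = - inverse (sqrt ?d) / 2"
      using real_sqrt_pow2[of "- ?d"] by (simp add: field_simps real_sqrt_minus flip: power2_eq_square)
  qed
  from DERIV_chain2[OF this has_field_derivative_det[OF M inv]]
  show ?thesis
    using nz by (simp add: field_simps)
qed

lemma det_differentiable:
  fixes M :: "'b::real_normed_vector \<Rightarrow> real^'n^'n"
  assumes "\<And>i j. (\<lambda>x. M x $ i $ j) differentiable (at x)"
  shows "(\<lambda>x. det (M x)) differentiable (at x)"
proof -
  have "(\<lambda>x. \<Prod>i\<in>UNIV. M x $ i $ p i) differentiable (at x)" for p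
  proof -
    have "\<forall>i. \<exists>D. ((\<lambda>x. M x $ i $ p i) has_derivative D) (at x)"
      using assms by (simp add: differentiable_def)
    then obtain D where "\<And>i. ((\<lambda>x. M x $ i $ p i) has_derivative D i) (at x)"
      by metis
    then have "((\<lambda>x. \<Prod>i\<in>UNIV. M x $ i $ p i) has_derivative
        (\<lambda>y. \<Sum>i\<in>UNIV. D i y * (\<Prod>j\<in>UNIV - {i}. M x $ j $ p j))) (at x)"
      by (intro has_derivative_prod)
    then show ?thesis by (auto simp: differentiable_def)
  qed
  then show ?thesis
    unfolding det_def by (intro differentiable_sum differentiable_mult differentiable_const) auto
qed

lemma matrix_inv_mult:
  assumes "invertible A"
  shows "A ** matrix_inv A = mat 1" "matrix_inv A ** A = mat 1"
  using someI_ex[OF assms[unfolded invertible_def]] by (simp_all add: matrix_inv_def)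

text \<open>Cramer's rule writes the entries of the inverse as quotients of determinants. It holds
  where the matrix is invertible, so the quotient is replaced by \<open>matrix_inv\<close> on the
  open set \<open>S\<close>.\<close>

lemma matrix_inv_differentiable:
  fixes M :: "'b::real_normed_vector \<Rightarrow> real^'n^'n"
  assumes M: "\<And>i j. (\<lambda>x. M x $ i $ j) differentiable (at x)"
    and S: "open S" "x \<in> S" and inv: "\<And>y. y \<in> S \<Longrightarrow> invertible (M y)"
  shows "(\<lambda>y. matrix_inv (M y) $ i $ j) differentiable (at x)"
proof -
  \<comment> \<open>Entry \<open>(i, j)\<close> is coordinate \<open>i\<close> of the solution
    \<open>u\<close> of \<open>M y *v u = axis j 1\<close>.\<close>
  let ?C = "\<lambda>y. det (\<chi> a b. if b = i then axis j 1 $ a else M y $ a $ b) / det (M y)"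
  have "(\<lambda>y. (\<chi> a b. if b = i then axis j 1 $ a else M y $ a $ b) $ a $ b) differentiable (at x)" for a b
    using M by (cases "b = i") auto
  then have "?C differentiable (at x)"
    using inv[OF S(2)] by (intro differentiable_divide det_differentiable M) (auto simp: invertible_det_nz)
  then obtain D where "(?C has_derivative D) (at x)"
    by (auto simp: differentiable_def)
  moreover have "?C y = matrix_inv (M y) $ i $ j" if "y \<in> S" for y
  proof -
    have "M y *v (matrix_inv (M y) *v axis j 1) = axis j 1"
      using matrix_inv_mult(1)[OF inv[OF that]] by (simp add: matrix_vector_mul_assoc)
    then have "matrix_inv (M y) *v axis j 1 =
        (\<chi> k. det (\<chi> a b. if b = k then axis j 1 $ a else M y $ a $ b) / det (M y))"
      using inv[OF that] by (subst (asm) cramer) (auto simp: invertible_det_nz)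
    then have "(matrix_inv (M y) *v axis j 1) $ i = ?C y"
      by simp
    then show ?thesis
      by (simp add: matrix_vector_mult_basis column_def)
  qed
  ultimately have "((\<lambda>y. matrix_inv (M y) $ i $ j) has_derivative D) (at x)"
    using has_derivative_transform_within_open[of ?C D x UNIV S] S by simp
  then show ?thesis by (auto simp: differentiable_def)
qed


section \<open>Second moments of a rotation invariant measure on a sphere\<close>

text \<open>The inner product varies with the point and is constrained only on the fibre, so its
  laws are relativized to \<open>H x\<close> instead of being expressed by a type class.\<close>

locale fibre_inner_product =
  fixes H :: "'a \<Rightarrow> ('a, 'n::finite) tvec set" and G :: "('a, 'n) metric" and x :: 'a
  assumes subspace: "subspace (H x)"
    and sym: "u \<in> H x \<Longrightarrow> v \<in> H x \<Longrightarrow> G x u v = G x v u"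
    and add_left: "u \<in> H x \<Longrightarrow> v \<in> H x \<Longrightarrow> w \<in> H x \<Longrightarrow> G x (u + v) w = G x u w + G x v w"
    and scale_left: "u \<in> H x \<Longrightarrow> v \<in> H x \<Longrightarrow> G x (a *\<^sub>R u) v = a * G x u v"
    and pos: "u \<in> H x \<Longrightarrow> u \<noteq> 0 \<Longrightarrow> G x u u > 0"
begin

lemma fibre_closed [simp]:
  "0 \<in> H x"
  "u \<in> H x \<Longrightarrow> v \<in> H x \<Longrightarrow> u + v \<in> H x"
  "u \<in> H x \<Longrightarrow> v \<in> H x \<Longrightarrow> u - v \<in> H x"
  "u \<in> H x \<Longrightarrow> a *\<^sub>R u \<in> H x"
  using subspace by (auto simp: subspace_0 subspace_add subspace_diff subspace_scale)

lemma add_right: "u \<in> H x \<Longrightarrow> v \<in> H x \<Longrightarrow> w \<in> H x \<Longrightarrow> G x w (u + v) = G x w u + G x w v"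
  using add_left sym by simp

lemma scale_right: "u \<in> H x \<Longrightarrow> v \<in> H x \<Longrightarrow> G x u (a *\<^sub>R v) = a * G x u v"
  using scale_left sym by simp

lemma diff_left: "u \<in> H x \<Longrightarrow> v \<in> H x \<Longrightarrow> w \<in> H x \<Longrightarrow> G x (u - v) w = G x u w - G x v w"
  using add_left[of "u - v" v w] by simp

lemma diff_right: "u \<in> H x \<Longrightarrow> v \<in> H x \<Longrightarrow> w \<in> H x \<Longrightarrow> G x w (u - v) = G x w u - G x w v"
  using diff_left sym by simp

lemmas bilinear = add_left add_right scale_left scale_right diff_left diff_right

lemma zero_left [simp]: "v \<in> H x \<Longrightarrow> G x 0 v = 0"
  using scale_left[of v v 0] scale_left[of 0 v 0] by simp

lemma zero_right [simp]: "v \<in> H x \<Longrightarrow> G x v 0 = 0"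
  using sym[of v 0] by simp

lemma sum_left:
  "(\<And>i. i \<in> I \<Longrightarrow> u i \<in> H x) \<Longrightarrow> v \<in> H x \<Longrightarrow> G x (\<Sum>i\<in>I. a i *\<^sub>R u i) v = (\<Sum>i\<in>I. a i * G x (u i) v)"
  by (induction I rule: infinite_finite_induct) (auto simp: bilinear subspace subspace_sum subspace_scale)

lemma nonneg: "u \<in> H x \<Longrightarrow> G x u u \<ge> 0"
  by (cases "u = 0") (auto dest: pos)

lemma Cauchy_Schwarz:
  assumes "u \<in> H x" "v \<in> H x"
  shows "\<bar>G x u v\<bar> \<le> sqrt (G x u u) * sqrt (G x v v)"
proof (cases "v = 0")
  case True
  then show ?thesis using assms by simp
next
  case False
  then have v: "G x v v > 0" using pos assms by blast
  \<comment> \<open>The component of \<open>u\<close> orthogonal to \<open>v\<close>, multiplied by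
    \<open>G x v v\<close> to avoid a division.\<close>
  define w where "w = G x v v *\<^sub>R u - G x u v *\<^sub>R v"
  have "w \<in> H x" using assms by (simp add: w_def)
  then have "0 \<le> G x w w" by (rule nonneg)
  also have "G x w w = G x v v * (G x u u * G x v v - (G x u v)\<^sup>2)"
    using assms by (simp add: w_def bilinear sym[of v u] algebra_simps power2_eq_square)
  finally have "(G x u v)\<^sup>2 \<le> G x u u * G x v v"
    using v by (simp add: zero_le_mult_iff)
  then have "sqrt ((G x u v)\<^sup>2) \<le> sqrt (G x u u * G x v v)"
    by (rule real_sqrt_le_mono)
  then show ?thesis by (simp add: real_sqrt_mult)
qed

section \<open>Hyperplane reflections of the fibre\<close>

definition reflect :: "('a, 'n) tvec \<Rightarrow> ('a, 'n) tvec \<Rightarrow> ('a, 'n) tvec" where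
  "reflect w v = v - (2 * G x v w / G x w w) *\<^sub>R w"

lemma reflect_closed [simp]: "w \<in> H x \<Longrightarrow> v \<in> H x \<Longrightarrow> reflect w v \<in> H x"
  by (simp add: reflect_def)

lemma reflect_isometric:
  assumes "w \<in> H x" "w \<noteq> 0" "u \<in> H x" "v \<in> H x"
  shows "G x (reflect w u) (reflect w v) = G x u v"
proof -
  have "G x w w \<noteq> 0" using pos[of w] assms by auto
  then show ?thesis
    using assms by (simp add: reflect_def bilinear sym[of w u] sym[of w v] field_simps)
qed

lemma reflect_involution:
  assumes "w \<in> H x" "w \<noteq> 0" "v \<in> H x"
  shows "reflect w (reflect w v) = v"
proof -
  have "G x w w \<noteq> 0" using pos[of w] assms by auto
  then have "G x (reflect w v) w = - G x v w"
    using assms by (simp add: reflect_def bilinear field_simps)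
  then show ?thesis by (simp add: reflect_def)
qed

text \<open>Reflections reverse orientation; they are admissible because invariance of the measure
  is demanded under the full orthogonal group of the fibre.\<close>

lemma fibre_isometry_reflect:
  assumes w: "w \<in> H x" "w \<noteq> 0"
  shows "fibre_isometry H G x (reflect w)"
  unfolding fibre_isometry_def
proof (intro conjI ballI allI)
  show "reflect w ` H x = H x"
    using w reflect_involution[OF w] by (metis (no_types, lifting) image_iff reflect_closed set_eqI)
  show "reflect w (u + v) = reflect w u + reflect w v" if "u \<in> H x" "v \<in> H x" for u v
    using w that by (simp add: reflect_def bilinear add_divide_distrib distrib_left scaleR_left_distrib)
  show "reflect w (a *\<^sub>R v) = a *\<^sub>R reflect w v" if "v \<in> H x" for a v
    using w that by (simp add: reflect_def bilinear scaleR_right_diff_distrib mult.left_commute)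
  show "G x (reflect w u) (reflect w v) = G x u v" if "u \<in> H x" "v \<in> H x" for u v
    using w that by (rule reflect_isometric)
qed

text \<open>Equal lengths make \<open>a + b\<close> orthogonal to \<open>a - b\<close>, so the
  reflection fixes the midpoint of the two vectors and negates their difference.\<close>

lemma reflect_swap:
  assumes "a \<in> H x" "b \<in> H x" "G x a a = G x b b" "a \<noteq> b"
  shows "reflect (a - b) b = a"
proof -
  have "G x (a - b) (a - b) > 0"
    using assms by (intro pos) auto
  moreover have "G x (a - b) (a - b) = - (2 * G x b (a - b))"
    using assms by (simp add: bilinear sym[of b a])
  ultimately have "2 * G x b (a - b) / G x (a - b) (a - b) = - 1"
    by (simp add: field_simps)
  then show ?thesis by (simp add: reflect_def)
qed

section \<open>Moments of the invariant measure\<close>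

context
  fixes \<mu> :: "('a, 'n) tvec measure"
  assumes rot: "rotation_invariant_probability H G x \<mu>"
begin

lemma space_eq: "space \<mu> = {v \<in> H x. G x v v = 1}"
  using rot by (simp add: rotation_invariant_probability_def horizontal_sphere_def)

lemma sets_eq: "sets \<mu> = sigma_sets (space \<mu>) {B. open_in_sphere H G x B}"
  using rot by (simp add: rotation_invariant_probability_def)

lemma emeasure_space_eq: "emeasure \<mu> (space \<mu>) = 1"
  using rot unfolding rotation_invariant_probability_def by blast

lemma finite_measure_sphere: "finite_measure \<mu>"
  by (rule finite_measureI) (simp add: emeasure_space_eq)

lemma open_in_sphere_sets: "open_in_sphere H G x B \<Longrightarrow> B \<in> sets \<mu>"
  by (auto simp: sets_eq)

text \<open>The sigma-algebra is generated by the sets open for the distance of \<open>G x\<close>.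
  By Cauchy-Schwarz the function is Lipschitz with constant the length of \<open>a\<close>, so
  preimages of open sets are such generators.\<close>

lemma inner_measurable [measurable]:
  assumes a: "a \<in> H x"
  shows "(\<lambda>v. G x v a) \<in> borel_measurable \<mu>"
proof (rule borel_measurableI)
  fix S :: "real set" assume S: "open S"
  let ?B = "(\<lambda>v. G x v a) -` S \<inter> space \<mu>"
  have "\<exists>e>0. \<forall>w\<in>horizontal_sphere H G x. sqrt (G x (w - v) (w - v)) < e \<longrightarrow> w \<in> ?B" if v: "v \<in> ?B" for v
  proof -
    obtain d where d: "d > 0" "\<And>y. \<bar>y - G x v a\<bar> < d \<Longrightarrow> y \<in> S"
      using S v unfolding open_real by blast
    define s where "s = sqrt (G x a a)"
    \<comment> \<open>Adding 1 keeps the radius positive also for \<open>a = 0\<close>, where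
      \<open>s = 0\<close>.\<close>
    let ?e = "d / (s + 1)"
    have aa: "s \<ge> 0" using nonneg[OF a] by (simp add: s_def)
    have "w \<in> ?B" if w: "w \<in> horizontal_sphere H G x" "sqrt (G x (w - v) (w - v)) < ?e" for w
    proof -
      have wv: "w \<in> H x" "v \<in> H x" using w v by (auto simp: space_eq horizontal_sphere_def)
      have "\<bar>G x w a - G x v a\<bar> = \<bar>G x (w - v) a\<bar>" using wv a by (simp add: bilinear)
      also have "\<dots> \<le> sqrt (G x (w - v) (w - v)) * s"
        unfolding s_def using wv a by (intro Cauchy_Schwarz) auto
      also have "\<dots> \<le> ?e * s"
        using w(2) aa by (intro mult_right_mono) auto
      also have "\<dots> < d"
        using d(1) aa by (simp add: field_simps)
      finally show ?thesis using d(2) w by (auto simp: space_eq horizontal_sphere_def)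
    qed
    moreover have "?e > 0" using d(1) aa by simp
    ultimately show ?thesis by blast
  qed
  then have "open_in_sphere H G x ?B"
    by (auto simp: open_in_sphere_def space_eq horizontal_sphere_def)
  then show "?B \<in> sets \<mu>" by (rule open_in_sphere_sets)
qed

lemma inner_bound: "v \<in> space \<mu> \<Longrightarrow> a \<in> H x \<Longrightarrow> \<bar>G x v a\<bar> \<le> sqrt (G x a a)"
  using Cauchy_Schwarz[of v a] by (simp add: space_eq)

lemma integrable_inner_mult:
  assumes "a \<in> H x" "b \<in> H x"
  shows "integrable \<mu> (\<lambda>v. G x v a * G x v b)"
proof -
  interpret finite_measure \<mu> by (rule finite_measure_sphere)
  show ?thesis
  proof (rule integrable_const_bound)
    show "AE v in \<mu>. norm (G x v a * G x v b) \<le> sqrt (G x a a) * sqrt (G x b b)"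
      using assms by (auto simp: abs_mult nonneg intro!: mult_mono inner_bound)
    show "(\<lambda>v. G x v a * G x v b) \<in> borel_measurable \<mu>"
      using assms by measurable
  qed
qed

text \<open>Invariance is stated for preimages of measurable sets; for a measurable \<open>R\<close>
  it says that the image measure is the measure itself. Measurability holds because an isometry
  pulls sets open in the sphere back to such sets.\<close>

lemma integral_fibre_isometry:
  assumes R: "fibre_isometry H G x R" and f: "f \<in> borel_measurable \<mu>"
  shows "(\<integral>v. f (R v) \<partial>\<mu>) = (\<integral>v. f v \<partial>\<mu> :: real)"
proof -
  have R_closed: "R v \<in> H x" if "v \<in> H x" for v
    using R that by (auto simp: fibre_isometry_def)
  have R_space: "R v \<in> space \<mu>" if "v \<in> space \<mu>" for v
    using R that by (auto simp: fibre_isometry_def space_eq)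
  have R_diff: "G x (R w - R v) (R w - R v) = G x (w - v) (w - v)" if "w \<in> H x" "v \<in> H x" for v w
    using R R_closed that by (simp add: bilinear fibre_isometry_def)
  have "R -` B \<inter> space \<mu> \<in> sets \<mu>" if B: "open_in_sphere H G x B" for B
  proof (rule open_in_sphere_sets)
    have "\<exists>e>0. \<forall>w\<in>horizontal_sphere H G x. sqrt (G x (w - v) (w - v)) < e \<longrightarrow> w \<in> R -` B \<inter> space \<mu>"
      if v: "v \<in> R -` B \<inter> space \<mu>" for v
    proof -
      obtain e where "e > 0" and
        e: "\<And>w. w \<in> horizontal_sphere H G x \<Longrightarrow> sqrt (G x (w - R v) (w - R v)) < e \<Longrightarrow> w \<in> B"
        using B v unfolding open_in_sphere_def by blast
      have "w \<in> R -` B \<inter> space \<mu>"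
        if w: "w \<in> horizontal_sphere H G x" "sqrt (G x (w - v) (w - v)) < e" for w
      proof -
        have w': "w \<in> space \<mu>" using w by (simp add: space_eq horizontal_sphere_def)
        then have "R w \<in> horizontal_sphere H G x"
          using R_space by (simp add: space_eq horizontal_sphere_def)
        moreover have "sqrt (G x (R w - R v) (R w - R v)) < e"
          using R_diff w w' v by (simp add: space_eq)
        ultimately show ?thesis using e w' by simp
      qed
      with \<open>e > 0\<close> show ?thesis by blast
    qed
    then show "open_in_sphere H G x (R -` B \<inter> space \<mu>)"
      by (auto simp: open_in_sphere_def space_eq horizontal_sphere_def)
  qed
  then have R_meas: "R \<in> measurable \<mu> \<mu>"
    using R_space by (intro measurable_sigma_sets[OF sets_eq]) (auto simp: open_in_sphere_def space_eq horizontal_sphere_def)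
  have "distr \<mu> \<mu> R = \<mu>"
    using R R_meas rot
    by (intro measure_eqI) (auto simp: emeasure_distr rotation_invariant_probability_def)
  then have "(\<integral>v. f v \<partial>\<mu>) = (\<integral>v. f v \<partial>distr \<mu> \<mu> R)" by simp
  also have "\<dots> = (\<integral>v. f (R v) \<partial>\<mu>)"
    using R_meas f by (rule integral_distr)
  finally show ?thesis ..
qed

text \<open>For distinct vectors, the reflection \<open>R\<close> in \<open>a - b\<close> takes
  \<open>b\<close> to \<open>a\<close>, so <Rv, a> = <Rv, Rb> = <v, b>, and the integral does not
  change under \<open>R\<close>.\<close>

lemma square_moment_eq:
  assumes "a \<in> H x" "b \<in> H x" "G x a a = G x b b"
  shows "(\<integral>v. (G x v a)\<^sup>2 \<partial>\<mu>) = (\<integral>v. (G x v b)\<^sup>2 \<partial>\<mu>)"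
proof (cases "a = b")
  case False
  define R where "R = reflect (a - b)"
  have w: "a - b \<in> H x" "a - b \<noteq> 0" using False assms by auto
  have "(\<integral>v. (G x v a)\<^sup>2 \<partial>\<mu>) = (\<integral>v. (G x (R v) a)\<^sup>2 \<partial>\<mu>)"
    unfolding R_def
    by (rule integral_fibre_isometry[OF fibre_isometry_reflect[OF w], symmetric]) (use assms in measurable)
  also have "\<dots> = (\<integral>v. (G x v b)\<^sup>2 \<partial>\<mu>)"
  proof (intro Bochner_Integration.integral_cong refl)
    fix v assume v: "v \<in> space \<mu>"
    have "G x (R v) (R b) = G x v b"
      unfolding R_def using w assms v by (intro reflect_isometric) (auto simp: space_eq)
    then show "(G x (R v) a)\<^sup>2 = (G x v b)\<^sup>2"
      using reflect_swap[OF assms False] by (simp add: R_def)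
  qed
  finally show ?thesis .
qed simp

text \<open>Comparing \<open>a\<close> with the multiple of one unit vector that has the same length
  shows that the square moment scales with \<open>G x a a\<close>. The constant stays abstract here:
  its value depends on the dimension, which enters only with a frame of the fibre.\<close>

lemma second_moment:
  obtains \<kappa> where "\<And>a b. a \<in> H x \<Longrightarrow> b \<in> H x \<Longrightarrow> (\<integral>v. G x v a * G x v b \<partial>\<mu>) = \<kappa> * G x a b"
proof -
  \<comment> \<open>Total mass 1 forces the sphere to be nonempty, which supplies the unit
    vector.\<close>
  have "space \<mu> \<noteq> {}"
    using emeasure_space_eq by auto
  then obtain e where e: "e \<in> H x" "G x e e = 1"
    by (auto simp: space_eq)
  define \<kappa> where "\<kappa> = (\<integral>v. (G x v e)\<^sup>2 \<partial>\<mu>)"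
  have sq: "(\<integral>v. (G x v a)\<^sup>2 \<partial>\<mu>) = \<kappa> * G x a a" if a: "a \<in> H x" for a
  proof -
    define r where "r = sqrt (G x a a)"
    have r: "r\<^sup>2 = G x a a" using nonneg[OF a] by (simp add: r_def)
    have "(\<integral>v. (G x v a)\<^sup>2 \<partial>\<mu>) = (\<integral>v. (G x v (r *\<^sub>R e))\<^sup>2 \<partial>\<mu>)"
      using a e r by (intro square_moment_eq) (auto simp: bilinear power2_eq_square)
    also have "\<dots> = (\<integral>v. r\<^sup>2 * (G x v e)\<^sup>2 \<partial>\<mu>)"
      using e by (intro Bochner_Integration.integral_cong) (auto simp: bilinear space_eq power_mult_distrib)
    finally show ?thesis by (simp add: \<kappa>_def r mult.commute)
  qed
  have "(\<integral>v. G x v a * G x v b \<partial>\<mu>) = \<kappa> * G x a b" if ab: "a \<in> H x" "b \<in> H x" for a b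
  proof -
    have int: "integrable \<mu> (\<lambda>v. (G x v c)\<^sup>2)" if "c \<in> H x" for c
      using integrable_inner_mult[OF that that] by (simp add: power2_eq_square)
    have "(\<integral>v. G x v a * G x v b \<partial>\<mu>) =
        (\<integral>v. ((G x v (a + b))\<^sup>2 - (G x v a)\<^sup>2 - (G x v b)\<^sup>2) / 2 \<partial>\<mu>)"
      using ab by (intro Bochner_Integration.integral_cong)
        (auto simp: bilinear space_eq power2_eq_square algebra_simps)
    also have "\<dots> = (\<kappa> * G x (a + b) (a + b) - \<kappa> * G x a a - \<kappa> * G x b b) / 2"
      using ab by (simp add: int sq)
    also have "\<dots> = \<kappa> * G x a b"
      using ab by (simp add: bilinear sym[of b a] algebra_simps)
    finally show ?thesis .
  qed
  then show ?thesis using that by blast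
qed

end

end


section \<open>Tangent vectors in coordinates\<close>

lemma comp_simps [simp]:
  "comp 0 c = 0" "comp (u + v) c = comp u c + comp v c" "comp (u - v) c = comp u c - comp v c"
  "comp (- u) c = - comp u c" "comp (a *\<^sub>R u) c = a *\<^sub>R comp u c" "comp (Tvec h) c = h c"
  by (simp_all add: zero_tvec_def plus_tvec_def minus_tvec_def uminus_tvec_def scaleR_tvec_def
      Tvec_inverse)

lemma comp_sum [simp]: "comp (\<Sum>i\<in>I. u i) c = (\<Sum>i\<in>I. comp (u i) c)"
  by (induction I rule: infinite_finite_induct) simp_all

lemma tvec_eqI: "(\<And>c. comp u c = comp v c) \<Longrightarrow> u = v"
  by (metis comp_inverse ext)

lemma coords_inv_chart [simp]: "x \<in> coords c ` dom_chart c \<Longrightarrow> coords c (inv_chart c x) = x"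
  by (simp add: inv_chart_def f_inv_into_f)

lemma inv_chart_in_dom [simp]: "x \<in> coords c ` dom_chart c \<Longrightarrow> inv_chart c x \<in> dom_chart c"
  by (simp add: inv_chart_def inv_into_into)

locale smooth_manifold =
  fixes X :: "'a topology" and A :: "('a, 'n::finite) chart set"
  assumes smooth_structure: "smooth_structure X A"
begin

lemma is_chart: "c \<in> A \<Longrightarrow> is_chart X c"
  using smooth_structure by (simp add: smooth_structure_def)

lemma openin_dom_chart: "c \<in> A \<Longrightarrow> openin X (dom_chart c)"
  using is_chart by (auto simp: is_chart_def)

lemma dom_chart_subset: "c \<in> A \<Longrightarrow> q \<in> dom_chart c \<Longrightarrow> q \<in> topspace X"
  using openin_dom_chart openin_subset by blast

lemma open_coords_image: "c \<in> A \<Longrightarrow> open (coords c ` dom_chart c)"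
  using is_chart by (auto simp: is_chart_def)

lemma homeomorphic_coords:
  "c \<in> A \<Longrightarrow>
    homeomorphic_map (subtopology X (dom_chart c)) (top_of_set (coords c ` dom_chart c)) (coords c)"
  using is_chart by (auto simp: is_chart_def)

lemma inj_coords: "c \<in> A \<Longrightarrow> inj_on (coords c) (dom_chart c)"
  using homeomorphic_imp_injective_map[OF homeomorphic_coords] openin_subset[OF openin_dom_chart]
  by (simp add: inf_absorb2)

lemma inv_chart_coords [simp]: "c \<in> A \<Longrightarrow> q \<in> dom_chart c \<Longrightarrow> inv_chart c (coords c q) = q"
  by (simp add: inv_chart_def inj_coords inv_into_f_f)

lemma open_coords_image_Int:
  assumes "c \<in> A" "openin X W"
  shows "open (coords c ` (dom_chart c \<inter> W))"
proof -
  have "openin (subtopology X (dom_chart c)) (dom_chart c \<inter> W)"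
    using assms(2) by (auto simp: openin_subtopology)
  then have "openin (top_of_set (coords c ` dom_chart c)) (coords c ` (dom_chart c \<inter> W))"
    using homeomorphic_imp_open_map[OF homeomorphic_coords[OF assms(1)]] by (simp add: open_map_def)
  then show ?thesis
    using open_coords_image[OF assms(1)] by (simp add: openin_open_eq)
qed

lemma pd_cong:
  assumes "c \<in> A" "q \<in> dom_chart c" "\<And>q'. q' \<in> dom_chart c \<Longrightarrow> f q' = f' q'"
  shows "pd c i f q = pd c i f' q"
  unfolding pd_def by (rule partial_cong[OF open_coords_image[OF assms(1)]]) (use assms in auto)

section \<open>Jacobians of coordinate changes\<close>

lemma transition_coords: "c \<in> A \<Longrightarrow> q \<in> dom_chart c \<Longrightarrow> transition c c' (coords c q) = coords c' q"
  by (simp add: transition_def)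

lemma smooth_transition:
  "c \<in> A \<Longrightarrow> c' \<in> A \<Longrightarrow>
    smooth_on (coords c ` (dom_chart c \<inter> dom_chart c')) (\<lambda>x. transition c c' x $ i)"
  using smooth_structure unfolding smooth_structure_def smooth_transition_def by blast

text \<open>Indexed by the point of the manifold rather than by its coordinates, so that the cocycle
  law has a single base point.\<close>

definition jacobian where
  "jacobian c c' q = frechet_derivative (transition c c') (at (coords c q))"

lemma has_derivative_transition:
  assumes "c \<in> A" "c' \<in> A" "q \<in> dom_chart c" "q \<in> dom_chart c'"
  shows "(transition c c' has_derivative jacobian c c' q) (at (coords c q))"
proof -
  have "(\<lambda>x. transition c c' x $ i) differentiable (at (coords c q))" for i
    by (rule smooth_on_differentiable[OF smooth_transition[OF assms(1,2)]]) (use assms in auto)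
  then have "(transition c c' has_derivative
      (\<lambda>v. \<chi> i. \<Sum>j\<in>UNIV. v $ j * partial j (\<lambda>x. transition c c' x $ i) (coords c q))) (at (coords c q))"
    by (simp add: has_derivative_components has_derivative_partial)
  then show ?thesis
    unfolding jacobian_def by (intro frechet_derivative_works[THEN iffD1] differentiableI)
qed

lemma partial_transition:
  assumes "c \<in> A" "c' \<in> A" "q \<in> dom_chart c" "q \<in> dom_chart c'"
  shows "partial i (\<lambda>x. transition c c' x $ k) (coords c q) = jacobian c c' q (axis i 1) $ k"
  using has_derivative_transition[OF assms] unfolding has_derivative_components
  by (intro partial_eq_derivative) blast

lemma jacobian_self:
  assumes "c \<in> A" "q \<in> dom_chart c"
  shows "jacobian c c q u = u"
proof -
  have "(transition c c has_derivative (\<lambda>u. u)) (at (coords c q))"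
    by (rule has_derivative_transform_within_open[OF has_derivative_ident open_coords_image[OF assms(1)]])
      (use assms in \<open>auto simp: transition_def\<close>)
  then have "(\<lambda>u. u) = jacobian c c q"
    unfolding jacobian_def by (rule frechet_derivative_at)
  then show ?thesis by metis
qed

lemma jacobian_cocycle:
  assumes "c \<in> A" "c' \<in> A" "c'' \<in> A" "q \<in> dom_chart c" "q \<in> dom_chart c'" "q \<in> dom_chart c''"
  shows "jacobian c' c'' q (jacobian c c' q u) = jacobian c c'' q u"
proof -
  have "(transition c' c'' has_derivative jacobian c' c'' q) (at (transition c c' (coords c q)))"
    using has_derivative_transition[of c' c'' q] assms by (simp add: transition_coords)
  with has_derivative_transition[of c c' q] assms
  have "((\<lambda>x. transition c' c'' (transition c c' x)) has_derivative
      (\<lambda>u. jacobian c' c'' q (jacobian c c' q u))) (at (coords c q))"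
    by (auto intro: has_derivative_compose)
  \<comment> \<open>On the overlap of \<open>c\<close> and \<open>c'\<close> both maps give the
    value of \<open>coords c''\<close> at the point, even where it has left the domain of
    \<open>c''\<close>.\<close>
  then have "(transition c c'' has_derivative (\<lambda>u. jacobian c' c'' q (jacobian c c' q u))) (at (coords c q))"
    by (rule has_derivative_transform_within_open[OF _ open_coords_image_Int[OF assms(1) openin_dom_chart[OF assms(2)]]])
      (use assms in \<open>auto simp: transition_coords\<close>)
  then have "(\<lambda>u. jacobian c' c'' q (jacobian c c' q u)) = jacobian c c'' q"
    unfolding jacobian_def by (rule frechet_derivative_at)
  then show ?thesis by metis
qed

lemma linear_jacobian:
  "c \<in> A \<Longrightarrow> c' \<in> A \<Longrightarrow> q \<in> dom_chart c \<Longrightarrow> q \<in> dom_chart c' \<Longrightarrow> linear (jacobian c c' q)"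
  using has_derivative_transition has_derivative_linear by blast

section \<open>Tangent spaces and coordinate fields\<close>

lemma tangent_comp:
  assumes "v \<in> tangent A q" "c \<in> A" "c' \<in> A" "q \<in> dom_chart c" "q \<in> dom_chart c'"
  shows "comp v c' = jacobian c c' q (comp v c)"
  using assms unfolding tangent_def jacobian_def by blast

lemma tangentI:
  assumes "\<And>c. \<not> (c \<in> A \<and> q \<in> dom_chart c) \<Longrightarrow> comp v c = 0"
    and "\<And>c c'. c \<in> A \<Longrightarrow> c' \<in> A \<Longrightarrow> q \<in> dom_chart c \<Longrightarrow> q \<in> dom_chart c' \<Longrightarrow>
      comp v c' = jacobian c c' q (comp v c)"
  shows "v \<in> tangent A q"
  using assms unfolding tangent_def jacobian_def by blast

lemma tangent_comp_0: "v \<in> tangent A q \<Longrightarrow> \<not> (c \<in> A \<and> q \<in> dom_chart c) \<Longrightarrow> comp v c = 0"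
  unfolding tangent_def by blast

lemma subspace_tangent: "subspace (tangent A q)"
proof (rule subspaceI)
  show "0 \<in> tangent A q"
    by (rule tangentI) (simp_all add: linear_jacobian linear_0)
next
  fix u v assume uv: "u \<in> tangent A q" "v \<in> tangent A q"
  show "u + v \<in> tangent A q"
  proof (rule tangentI)
    fix c c' assume c: "c \<in> A" "c' \<in> A" "q \<in> dom_chart c" "q \<in> dom_chart c'"
    show "comp (u + v) c' = jacobian c c' q (comp (u + v) c)"
      using tangent_comp[OF uv(1) c] tangent_comp[OF uv(2) c] linear_add[OF linear_jacobian[OF c]] by simp
  qed (simp add: tangent_comp_0[OF uv(1)] tangent_comp_0[OF uv(2)])
next
  fix a u assume u: "u \<in> tangent A q"
  show "a *\<^sub>R u \<in> tangent A q"
  proof (rule tangentI)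
    fix c c' assume c: "c \<in> A" "c' \<in> A" "q \<in> dom_chart c" "q \<in> dom_chart c'"
    show "comp (a *\<^sub>R u) c' = jacobian c c' q (comp (a *\<^sub>R u) c)"
      using tangent_comp[OF u c] linear_cmul[OF linear_jacobian[OF c]] by simp
  qed (simp add: tangent_comp_0[OF u])
qed

text \<open>Inverse to reading components in \<open>c\<close>. The default 0 is the normalization
  that \<open>tangent\<close> imposes on charts away from \<open>q\<close>.\<close>

definition tvec_of :: "('a, 'n) chart \<Rightarrow> 'a \<Rightarrow> real^'n \<Rightarrow> ('a, 'n) tvec" where
  "tvec_of c q u = Tvec (\<lambda>c'. if c' \<in> A \<and> q \<in> dom_chart c' then jacobian c c' q u else 0)"

lemma coord_vec_eq: "coord_vec A c i q = tvec_of c q (axis i 1)"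
  unfolding coord_vec_def tvec_of_def jacobian_def ..

lemma tvec_of_tangent [simp]: "c \<in> A \<Longrightarrow> q \<in> dom_chart c \<Longrightarrow> tvec_of c q u \<in> tangent A q"
  by (rule tangentI) (auto simp: tvec_of_def jacobian_cocycle)

lemma comp_tvec_of [simp]: "c \<in> A \<Longrightarrow> q \<in> dom_chart c \<Longrightarrow> comp (tvec_of c q u) c = u"
  by (simp add: tvec_of_def jacobian_self)

lemma coord_vec_tangent [simp]: "c \<in> A \<Longrightarrow> q \<in> dom_chart c \<Longrightarrow> coord_vec A c i q \<in> tangent A q"
  by (simp add: coord_vec_eq)

lemma comp_coord_vec [simp]: "c \<in> A \<Longrightarrow> q \<in> dom_chart c \<Longrightarrow> comp (coord_vec A c i q) c = axis i 1"
  by (simp add: coord_vec_eq)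

lemma tangent_eqI:
  assumes "c \<in> A" "q \<in> dom_chart c" "u \<in> tangent A q" "v \<in> tangent A q" "comp u c = comp v c"
  shows "u = v"
proof (rule tvec_eqI)
  fix c'
  show "comp u c' = comp v c'"
    using assms tangent_comp[of _ q c c'] tangent_comp_0[of _ q c']
    by (cases "c' \<in> A \<and> q \<in> dom_chart c'") simp_all
qed

lemma tangent_expansion:
  assumes "c \<in> A" "q \<in> dom_chart c" "v \<in> tangent A q"
  shows "v = (\<Sum>i\<in>UNIV. comp v c $ i *\<^sub>R coord_vec A c i q)"
proof (rule tangent_eqI[OF assms])
  show "(\<Sum>i\<in>UNIV. comp v c $ i *\<^sub>R coord_vec A c i q) \<in> tangent A q"
    using assms by (intro subspace_sum subspace_scale subspace_tangent) auto
  show "comp v c = comp (\<Sum>i\<in>UNIV. comp v c $ i *\<^sub>R coord_vec A c i q) c"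
    using assms basis_expansion[of "comp v c"] by (simp add: scalar_mult_eq_scaleR)
qed

text \<open>Here \<open>dim\<close> refers to the ambient space of all families of components, so a
  basis is exhibited. Comparison with the rank of the sub-bundle determines
  \<open>m\<close>.\<close>

lemma dim_tangent:
  assumes c: "c \<in> A" "q \<in> dom_chart c"
  shows "dim (tangent A q) = CARD('n)"
proof -
  let ?e = "\<lambda>i. coord_vec A c i q"
  have inj: "inj ?e"
  proof (rule injI)
    fix i j assume "?e i = ?e j"
    then have "comp (?e i) c = comp (?e j) c" by simp
    then show "i = j" using c by (simp add: axis_eq_axis)
  qed
  have "span (range ?e) = tangent A q"
  proof
    show "span (range ?e) \<subseteq> tangent A q"
      using c by (intro span_minimal subspace_tangent) auto
    show "tangent A q \<subseteq> span (range ?e)"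
    proof
      fix v assume "v \<in> tangent A q"
      then have "v = (\<Sum>i\<in>UNIV. comp v c $ i *\<^sub>R ?e i)"
        by (rule tangent_expansion[OF c])
      also have "\<dots> \<in> span (range ?e)"
        by (intro span_sum span_scale span_base) auto
      finally show "v \<in> span (range ?e)" .
    qed
  qed
  moreover have "independent (range ?e)"
  proof (rule independent_if_scalars_zero)
    fix f and w assume sum: "(\<Sum>v\<in>range ?e. f v *\<^sub>R v) = 0" and w: "w \<in> range ?e"
    from w obtain i where i: "w = ?e i" by blast
    have "(\<Sum>j\<in>UNIV. f (?e j) *\<^sub>R ?e j) = 0"
      using sum by (simp add: sum.reindex[OF inj])
    then have "comp (\<Sum>j\<in>UNIV. f (?e j) *\<^sub>R ?e j) c $ i = 0"
      by simp
    then show "f w = 0"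
      using c by (simp add: i axis_def if_distrib[of "\<lambda>y. _ * y"] cong: if_cong)
  qed simp
  ultimately have "dim (tangent A q) = card (range ?e)"
    by (metis dim_eq_card span_eq_iff subspace_tangent)
  then show ?thesis
    using inj by (simp add: card_image)
qed

text \<open>Smoothness of a metric is a statement about pairs of smooth fields; inserting coordinate
  fields makes the metric coefficients smooth. Smoothness of a field has to be checked in all
  charts, hence the second chart \<open>c'\<close>.\<close>

lemma smooth_field_coord_vec:
  assumes c: "c \<in> A"
  shows "smooth_field_on A (dom_chart c) (coord_vec A c i)"
  unfolding smooth_field_on_def
proof (intro conjI ballI allI)
  fix c' k assume c': "c' \<in> A"
  let ?S = "coords c' ` (dom_chart c' \<inter> dom_chart c)" and ?T = "coords c ` (dom_chart c \<inter> dom_chart c')"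
  have S: "open ?S"
    using c c' by (intro open_coords_image_Int openin_dom_chart)
  have "smooth_on ?S (\<lambda>x. partial i (\<lambda>y. transition c c' y $ k) (transition c' c x))"
  proof (rule smooth_on_compose[OF S])
    show "transition c' c x \<in> ?T" if "x \<in> ?S" for x
      using that c' by (auto simp: transition_coords)
    show "smooth_on ?S (\<lambda>x. transition c' c x $ j)" for j
      using c' c by (rule smooth_transition)
    show "smooth_on ?T (partial i (\<lambda>y. transition c c' y $ k))"
      using c c' by (intro smooth_on_partial smooth_transition)
  qed
  then show "smooth_on ?S (\<lambda>x. comp (coord_vec A c i (inv_chart c' x)) c' $ k)"
  proof (rule smooth_on_cong[OF S, rotated])
    fix x assume "x \<in> ?S"
    then obtain q where q: "q \<in> dom_chart c" "q \<in> dom_chart c'" "x = coords c' q" by blast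
    then show "partial i (\<lambda>y. transition c c' y $ k) (transition c' c x) =
        comp (coord_vec A c i (inv_chart c' x)) c' $ k"
      using c c' by (simp add: transition_coords partial_transition coord_vec_eq tvec_of_def)
  qed
qed (use c in simp)

end


section \<open>Riemannian metrics in coordinates\<close>

text \<open>\<open>H\<close> stays separate from \<open>tangent A\<close> because the two are
  required to agree only over points of the manifold.\<close>

locale full_sub_riemannian = smooth_manifold X A
  for X :: "'a topology" and A :: "('a, 'n::finite) chart set" +
  fixes H :: "'a \<Rightarrow> ('a, 'n) tvec set" and G :: "('a, 'n) metric"
  assumes full: "q \<in> topspace X \<Longrightarrow> H q = tangent A q"
    and fibre_metric: "smooth_fibre_metric X A H G"
begin

lemma fibre_inner_product: "q \<in> topspace X \<Longrightarrow> fibre_inner_product H G q"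
  using fibre_metric full[of q] subspace_tangent[of q]
  unfolding smooth_fibre_metric_def fibre_inner_product_def by simp

lemma full_chart: "c \<in> A \<Longrightarrow> q \<in> dom_chart c \<Longrightarrow> H q = tangent A q"
  using full dom_chart_subset by blast

lemma fibre_chart: "c \<in> A \<Longrightarrow> q \<in> dom_chart c \<Longrightarrow> fibre_inner_product H G q"
  using fibre_inner_product dom_chart_subset by blast

definition gram :: "('a, 'n) chart \<Rightarrow> 'a \<Rightarrow> real^'n^'n" where
  "gram c q = (\<chi> i j. metric_coeff A G c i j q)"

lemma metric_coords:
  assumes c: "c \<in> A" "q \<in> dom_chart c" and uv: "u \<in> tangent A q" "v \<in> tangent A q"
  shows "G q u v = (\<Sum>i\<in>UNIV. comp u c $ i * (gram c q *v comp v c) $ i)"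
proof -
  interpret fibre_inner_product H G q by (rule fibre_chart[OF c])
  have H: "H q = tangent A q" by (rule full_chart[OF c])
  have right: "G q (coord_vec A c i q) v = (gram c q *v comp v c) $ i" for i
  proof -
    have "G q (coord_vec A c i q) v = G q v (coord_vec A c i q)"
      using c uv by (intro sym) (simp_all add: H)
    also have "\<dots> = G q (\<Sum>j\<in>UNIV. comp v c $ j *\<^sub>R coord_vec A c j q) (coord_vec A c i q)"
      using tangent_expansion[OF c uv(2)] by simp
    also have "\<dots> = (\<Sum>j\<in>UNIV. comp v c $ j * G q (coord_vec A c j q) (coord_vec A c i q))"
      using c by (intro sum_left) (simp_all add: H)
    also have "\<dots> = (\<Sum>j\<in>UNIV. G q (coord_vec A c i q) (coord_vec A c j q) * comp v c $ j)"
      using c by (intro sum.cong refl) (simp add: H sym mult.commute)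
    finally show ?thesis
      by (simp add: matrix_vector_mult_def gram_def metric_coeff_def)
  qed
  have "G q u v = G q (\<Sum>i\<in>UNIV. comp u c $ i *\<^sub>R coord_vec A c i q) v"
    using tangent_expansion[OF c uv(1)] by simp
  also have "\<dots> = (\<Sum>i\<in>UNIV. comp u c $ i * G q (coord_vec A c i q) v)"
    using c uv by (intro sum_left) (simp_all add: H)
  finally show ?thesis by (simp add: right)
qed

text \<open>A vector in the kernel would be the component vector of a tangent vector of length
  zero.\<close>

lemma invertible_gram:
  assumes c: "c \<in> A" "q \<in> dom_chart c"
  shows "invertible (gram c q)"
proof -
  interpret fibre_inner_product H G q by (rule fibre_chart[OF c])
  have "u = 0" if "gram c q *v u = 0" for u
  proof -
    have "G q (tvec_of c q u) (tvec_of c q u) = 0"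
      using c that by (simp add: metric_coords)
    then have "tvec_of c q u = 0"
      using pos[of "tvec_of c q u"] c by (auto simp: full_chart)
    then have "comp (tvec_of c q u) c = 0" by simp
    then show ?thesis using c by simp
  qed
  then show ?thesis
    by (simp add: invertible_left_inverse matrix_left_invertible_ker)
qed

lemma inverse_gram_pairing:
  assumes c: "c \<in> A" "q \<in> dom_chart c" and v: "v \<in> tangent A q"
  shows "G q (tvec_of c q (matrix_inv (gram c q) *v \<xi>)) v = covec_of A c q \<xi> v"
proof -
  let ?u = "tvec_of c q (matrix_inv (gram c q) *v \<xi>)"
  have "G q ?u v = G q v ?u"
    by (rule fibre_inner_product.sym[OF fibre_chart[OF c]]) (use c v in \<open>simp_all add: full_chart\<close>)
  also have "\<dots> = (\<Sum>i\<in>UNIV. comp v c $ i * (gram c q *v (matrix_inv (gram c q) *v \<xi>)) $ i)"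
    using c v by (simp add: metric_coords)
  also have "gram c q *v (matrix_inv (gram c q) *v \<xi>) = \<xi>"
    using invertible_gram[OF c] by (simp add: matrix_vector_mul_assoc matrix_inv_mult)
  finally show ?thesis
    using v by (simp add: covec_of_def mult.commute)
qed

text \<open>This description occurs in both \<open>beta\<close> and \<open>gradient\<close>, so both
  become raising an index with the inverse Gram matrix. Uniqueness is positive definiteness: the
  difference of two solutions pairs to zero with itself.\<close>

lemma Riesz:
  assumes c: "c \<in> A" "q \<in> dom_chart c"
  shows "(THE u. u \<in> tangent A q \<and> (\<forall>v\<in>tangent A q. G q u v = covec_of A c q \<xi> v)) =
    tvec_of c q (matrix_inv (gram c q) *v \<xi>)"
proof (rule the_equality)
  interpret fibre_inner_product H G q by (rule fibre_chart[OF c])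
  have H: "H q = tangent A q" by (rule full_chart[OF c])
  let ?u = "tvec_of c q (matrix_inv (gram c q) *v \<xi>)"
  show "?u \<in> tangent A q \<and> (\<forall>v\<in>tangent A q. G q ?u v = covec_of A c q \<xi> v)"
    using c by (simp add: inverse_gram_pairing)
  fix u assume u: "u \<in> tangent A q \<and> (\<forall>v\<in>tangent A q. G q u v = covec_of A c q \<xi> v)"
  then have d: "u \<in> H q" "?u \<in> H q" "u - ?u \<in> H q"
    using c by (simp_all add: H subspace_diff subspace_tangent)
  then have "G q (u - ?u) (u - ?u) = G q u (u - ?u) - G q ?u (u - ?u)"
    by (intro diff_left)
  also have "\<dots> = 0"
    using u d(3) inverse_gram_pairing[OF c, of "u - ?u"] by (simp add: H)
  finally have "u - ?u = 0" using pos[OF d(3)] by (metis less_irrefl)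
  then show "u = ?u" by simp
qed

section \<open>The bundle map \<open>beta\<close> and the Hamiltonian in coordinates\<close>

lemma beta_covec:
  "c \<in> A \<Longrightarrow> q \<in> dom_chart c \<Longrightarrow>
    beta H G q (covec_of A c q \<xi>) = tvec_of c q (matrix_inv (gram c q) *v \<xi>)"
  by (simp add: beta_def Riesz full_chart)

lemma beta_covec_pairing:
  "c \<in> A \<Longrightarrow> q \<in> dom_chart c \<Longrightarrow> v \<in> tangent A q \<Longrightarrow>
    G q (beta H G q (covec_of A c q \<xi>)) v = covec_of A c q \<xi> v"
  by (simp add: beta_covec inverse_gram_pairing)

lemma beta_dx_tangent [simp]: "c \<in> A \<Longrightarrow> q \<in> dom_chart c \<Longrightarrow> beta H G q (dx A c i q) \<in> tangent A q"
  by (simp add: dx_def beta_covec)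

lemma dx_apply: "v \<in> tangent A q \<Longrightarrow> dx A c i q v = comp v c $ i"
  by (simp add: dx_def covec_of_def axis_def if_distrib[of "\<lambda>y. y * _"] cong: if_cong)

text \<open>It turns a component of \<open>v\<close> into an inner product with a fixed vector, the
  form in which the moments of the measure apply.\<close>

lemma beta_dx_pairing:
  "c \<in> A \<Longrightarrow> q \<in> dom_chart c \<Longrightarrow> v \<in> tangent A q \<Longrightarrow> G q (beta H G q (dx A c i q)) v = comp v c $ i"
  using beta_covec_pairing[of c q v "axis i 1"] dx_apply[of v q c i] by (simp add: dx_def)

lemma beta_coeff_eq:
  assumes c: "c \<in> A" "q \<in> dom_chart c"
  shows "beta_coeff A H G c i j q = matrix_inv (gram c q) $ i $ j"
proof -
  have "beta_coeff A H G c i j q = comp (beta H G q (dx A c j q)) c $ i"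
    unfolding beta_coeff_def using c by (intro beta_dx_pairing) simp_all
  also have "\<dots> = matrix_inv (gram c q) $ i $ j"
    using c by (simp add: dx_def beta_covec matrix_vector_mult_basis column_def)
  finally show ?thesis .
qed

lemma beta_coeff_sym: "c \<in> A \<Longrightarrow> q \<in> dom_chart c \<Longrightarrow> beta_coeff A H G c i j q = beta_coeff A H G c j i q"
  using fibre_inner_product.sym[OF fibre_chart, of c q] by (simp add: beta_coeff_def full_chart)

lemma metric_coeff_sym: "c \<in> A \<Longrightarrow> q \<in> dom_chart c \<Longrightarrow> metric_coeff A G c i j q = metric_coeff A G c j i q"
  using fibre_inner_product.sym[OF fibre_chart, of c q] by (simp add: metric_coeff_def full_chart)

lemma beta_metric_inverse:
  assumes c: "c \<in> A" "q \<in> dom_chart c"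
  shows "(\<Sum>k\<in>UNIV. beta_coeff A H G c i k q * metric_coeff A G c k j q) = (if i = j then 1 else 0)"
proof -
  have "(\<Sum>k\<in>UNIV. beta_coeff A H G c i k q * metric_coeff A G c k j q) =
      (matrix_inv (gram c q) ** gram c q) $ i $ j"
    using c by (simp add: matrix_matrix_mult_def beta_coeff_eq) (simp add: gram_def)
  then show ?thesis
    using invertible_gram[OF c] by (simp add: matrix_inv_mult mat_def)
qed

lemma hamiltonian_coords_eq:
  assumes c: "c \<in> A" and x: "x \<in> coords c ` dom_chart c"
  shows "hamiltonian_coords A H G c x \<xi> =
    1/2 * (\<Sum>i\<in>UNIV. \<Sum>j\<in>UNIV. \<xi> $ i * \<xi> $ j * beta_coeff A H G c i j (inv_chart c x))"
proof -
  let ?q = "inv_chart c x"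
  have q: "?q \<in> dom_chart c" using x by simp
  have "hamiltonian_coords A H G c x \<xi> =
      1/2 * covec_of A c ?q \<xi> (tvec_of c ?q (matrix_inv (gram c ?q) *v \<xi>))"
    unfolding hamiltonian_coords_def hamiltonian_def fst_conv snd_conv
    by (subst beta_covec_pairing) (use c q in \<open>simp_all add: beta_covec\<close>)
  also have "covec_of A c ?q \<xi> (tvec_of c ?q (matrix_inv (gram c ?q) *v \<xi>)) =
      (\<Sum>i\<in>UNIV. \<Sum>j\<in>UNIV. \<xi> $ i * \<xi> $ j * beta_coeff A H G c i j ?q)"
    using c q by (simp add: covec_of_def matrix_vector_mult_def beta_coeff_eq sum_distrib_left ac_simps)
  finally show ?thesis .
qed

lemma metric_coeff_differentiable:
  assumes c: "c \<in> A" and x: "x \<in> coords c ` dom_chart c"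
  shows "(\<lambda>y. metric_coeff A G c i j (inv_chart c y)) differentiable (at x)"
proof -
  have "smooth_fun_on A (dom_chart c) (\<lambda>q. G q (coord_vec A c i q) (coord_vec A c j q))"
    using fibre_metric openin_dom_chart[OF c] smooth_field_coord_vec[OF c] full_chart[OF c] c
    unfolding smooth_fibre_metric_def by simp
  then have "smooth_on (coords c ` (dom_chart c \<inter> dom_chart c))
      ((\<lambda>q. G q (coord_vec A c i q) (coord_vec A c j q)) \<circ> inv_chart c)"
    using c unfolding smooth_fun_on_def by blast
  then show ?thesis
    using x by (intro smooth_on_differentiable) (auto simp: metric_coeff_def o_def)
qed

lemma beta_coeff_differentiable:
  assumes c: "c \<in> A" and x: "x \<in> coords c ` dom_chart c"
  shows "(\<lambda>y. beta_coeff A H G c i j (inv_chart c y)) differentiable (at x)"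
proof (rule differentiable_cong_open[OF open_coords_image[OF c] x])
  show "(\<lambda>y. matrix_inv (gram c (inv_chart c y)) $ i $ j) differentiable (at x)"
  proof (rule matrix_inv_differentiable[OF _ open_coords_image[OF c] x])
    show "(\<lambda>y. gram c (inv_chart c y) $ i $ j) differentiable (at x)" for i j
      using metric_coeff_differentiable[OF c x] by (simp add: gram_def)
    show "invertible (gram c (inv_chart c y))" if "y \<in> coords c ` dom_chart c" for y
      using c that by (intro invertible_gram) simp_all
  qed
qed (use c in \<open>simp add: beta_coeff_eq\<close>)

end


section \<open>The Hamiltonian flow\<close>

lemma has_field_derivative_along_curve:
  fixes K :: "real^'n \<Rightarrow> real" and x :: "real \<Rightarrow> real^'n"
  assumes x: "\<And>i. ((\<lambda>s. x s $ i) has_field_derivative x' i) (at t)" and K: "K differentiable (at (x t))"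
  shows "((\<lambda>s. K (x s)) has_field_derivative (\<Sum>i\<in>UNIV. x' i * partial i K (x t))) (at t)"
proof -
  have "(x has_derivative (\<lambda>s. \<chi> i. x' i * s)) (at t)"
    using x by (simp add: has_derivative_components has_field_derivative_def)
  from has_derivative_compose[OF this has_derivative_partial[OF K]]
  have "((\<lambda>s. K (x s)) has_derivative (\<lambda>s. \<Sum>i\<in>UNIV. x' i * s * partial i K (x t))) (at t)"
    by simp
  moreover have "(\<Sum>i\<in>UNIV. x' i * s * partial i K (x t)) = (\<Sum>i\<in>UNIV. x' i * partial i K (x t)) * s" for s
    by (simp add: sum_distrib_left ac_simps)
  ultimately show ?thesis
    by (simp add: has_field_derivative_def)
qed

context full_sub_riemannian
begin

lemma partial_hamiltonian_momentum:
  assumes c: "c \<in> A" "q \<in> dom_chart c"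
  shows "partial i (\<lambda>\<eta>. hamiltonian_coords A H G c (coords c q) \<eta>) \<xi> =
    (\<Sum>j\<in>UNIV. beta_coeff A H G c i j q * \<xi> $ j)"
proof -
  have "((\<lambda>\<eta>. 1/2 * (\<Sum>a\<in>UNIV. \<Sum>b\<in>UNIV. \<eta> $ a * \<eta> $ b * beta_coeff A H G c a b q)) has_derivative
      (\<lambda>\<eta>. 1/2 * (\<Sum>a\<in>UNIV. \<Sum>b\<in>UNIV. (\<xi> $ a * \<eta> $ b + \<eta> $ a * \<xi> $ b) * beta_coeff A H G c a b q))) (at \<xi>)"
    by (intro has_derivative_mult_right has_derivative_sum has_derivative_mult_left has_derivative_mult
        bounded_linear_imp_has_derivative bounded_linear_vec_nth)
  moreover have "(\<lambda>\<eta>. hamiltonian_coords A H G c (coords c q) \<eta>) =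
      (\<lambda>\<eta>. 1/2 * (\<Sum>a\<in>UNIV. \<Sum>b\<in>UNIV. \<eta> $ a * \<eta> $ b * beta_coeff A H G c a b q))"
    using c by (simp add: hamiltonian_coords_eq fun_eq_iff)
  ultimately have "partial i (\<lambda>\<eta>. hamiltonian_coords A H G c (coords c q) \<eta>) \<xi> =
      1/2 * (\<Sum>a\<in>UNIV. \<Sum>b\<in>UNIV. (\<xi> $ a * axis i 1 $ b + axis i 1 $ a * \<xi> $ b) * beta_coeff A H G c a b q)"
    by (simp only: partial_eq_derivative)
  also have "(\<Sum>a\<in>UNIV. \<Sum>b\<in>UNIV. (\<xi> $ a * axis i 1 $ b + axis i 1 $ a * \<xi> $ b) * beta_coeff A H G c a b q) =
      (\<Sum>a\<in>UNIV. \<xi> $ a * (\<Sum>b\<in>UNIV. axis i 1 $ b * beta_coeff A H G c a b q)) +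
      (\<Sum>a\<in>UNIV. axis i 1 $ a * (\<Sum>b\<in>UNIV. \<xi> $ b * beta_coeff A H G c a b q))"
    by (simp only: distrib_right sum.distrib sum_distrib_left mult.assoc)
  also have "\<dots> = (\<Sum>a\<in>UNIV. \<xi> $ a * beta_coeff A H G c a i q) + (\<Sum>b\<in>UNIV. \<xi> $ b * beta_coeff A H G c i b q)"
    by (simp only: sum_axis)
  also have "\<dots> = 2 * (\<Sum>j\<in>UNIV. beta_coeff A H G c i j q * \<xi> $ j)"
    using beta_coeff_sym[OF c, of _ i] by (simp add: mult.commute)
  finally show ?thesis by simp
qed

lemma partial_hamiltonian_position:
  assumes c: "c \<in> A" "q \<in> dom_chart c"
  shows "partial i (\<lambda>y. hamiltonian_coords A H G c y \<xi>) (coords c q) =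
    1/2 * (\<Sum>a\<in>UNIV. \<Sum>b\<in>UNIV. \<xi> $ a * \<xi> $ b * pd c i (beta_coeff A H G c a b) q)"
proof -
  have x: "coords c q \<in> coords c ` dom_chart c" using c by simp
  have "partial i (\<lambda>y. hamiltonian_coords A H G c y \<xi>) (coords c q) =
      partial i (\<lambda>y. 1/2 * (\<Sum>a\<in>UNIV. \<Sum>b\<in>UNIV. \<xi> $ a * \<xi> $ b * beta_coeff A H G c a b (inv_chart c y))) (coords c q)"
    by (rule partial_cong[OF open_coords_image[OF c(1)] x]) (rule hamiltonian_coords_eq[OF c(1)])
  also have "\<dots> = 1/2 * (\<Sum>a\<in>UNIV. \<Sum>b\<in>UNIV. \<xi> $ a * \<xi> $ b *
      (\<Sum>l\<in>UNIV. axis i 1 $ l * partial l (\<lambda>y. beta_coeff A H G c a b (inv_chart c y)) (coords c q)))"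
    by (intro partial_eq_derivative has_derivative_mult_right has_derivative_sum has_derivative_partial
        beta_coeff_differentiable c x)
  finally show ?thesis by (simp add: pd_def o_def)
qed

text \<open>The initial covector \<open>g(\<cdot>, v)\<close> has the coordinates \<open>\<xi>\<close>, and its initial velocity
  \<open>\<beta>\<^sup>i\<^sup>j \<xi>\<^sub>j\<close> is again \<open>v\<^sup>i\<close>, which is why components of \<open>v\<close> occur besides those of \<open>\<xi>\<close>.\<close>

lemma flow_second_derivative:
  assumes flow: "hamiltonian_flow X A H G \<Phi>" and f: "smooth_fun_on A (topspace X) f"
    and c: "c \<in> A" "q \<in> dom_chart c" and v: "v \<in> tangent A q"
  defines "\<xi> \<equiv> \<lambda>j. G q v (coord_vec A c j q)"
  shows "deriv (\<lambda>t. deriv (\<lambda>s. f (fst (\<Phi> (t + s) (q, flat A G q v)))) 0) 0 =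
    (\<Sum>i\<in>UNIV. (\<Sum>j\<in>UNIV. comp v c $ j * pd c j (pd c i f) q) * comp v c $ i +
      pd c i f q * (\<Sum>j\<in>UNIV. (\<Sum>l\<in>UNIV. comp v c $ l * pd c l (beta_coeff A H G c i j) q) * \<xi> j -
        beta_coeff A H G c i j q *
          (1/2 * (\<Sum>a\<in>UNIV. \<Sum>b\<in>UNIV. \<xi> a * \<xi> b * pd c j (beta_coeff A H G c a b) q))))"
proof -
  interpret fibre_inner_product H G q by (rule fibre_chart[OF c])
  have H: "H q = tangent A q" by (rule full_chart[OF c])
  let ?p = "flat A G q v"
  define \<gamma> where "\<gamma> t = \<Phi> t (q, ?p)" for t
  define x where "x t = coords c (fst (\<gamma> t))" for t
  define \<zeta> where "\<zeta> t = momenta A c (\<gamma> t)" for t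
  define F where "F = f \<circ> inv_chart c"
  define b where "b i j y = beta_coeff A H G c i j (inv_chart c y)" for i j y
  have "?p \<in> cotangent A q"
    using v unfolding cotangent_def flat_def
    by (auto simp: add_left scale_left H subspace_add subspace_scale subspace_tangent)
  moreover have q: "q \<in> topspace X" using c by (rule dom_chart_subset)
  ultimately obtain e where e: "e > 0" and \<gamma>0: "\<gamma> 0 = (q, ?p)"
    and curve: "hamiltonian_curve_on X A H G {-e<..<e} \<gamma>"
    using flow unfolding hamiltonian_flow_def \<gamma>_def by blast
  \<comment> \<open>The times at which the curve is in the chart. Continuity of the base curve makes
    this set open, and on it Hamilton's equations can be read in \<open>c\<close>.\<close>
  define J where "J = {t \<in> {-e<..<e}. fst (\<gamma> t) \<in> dom_chart c}"
  have "continuous_map (top_of_set {-e<..<e}) X (\<lambda>t. fst (\<gamma> t))"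
    using curve by (simp add: hamiltonian_curve_on_def)
  from openin_continuous_map_preimage[OF this openin_dom_chart[OF c(1)]]
  have "open J" by (simp add: J_def openin_open_eq)
  have J0: "0 \<in> J" using e \<gamma>0 c by (simp add: J_def)
  have x0: "x 0 = coords c q" by (simp add: x_def \<gamma>0)
  have dom: "fst (\<gamma> t) \<in> dom_chart c" "x t \<in> coords c ` dom_chart c" if "t \<in> J" for t
    using that by (simp_all add: J_def x_def)
  have dx: "((\<lambda>s. x s $ i) has_field_derivative (\<Sum>j\<in>UNIV. b i j (x t) * \<zeta> t $ j)) (at t)"
    and d\<zeta>: "((\<lambda>s. \<zeta> s $ i) has_field_derivative
      - (1/2 * (\<Sum>k\<in>UNIV. \<Sum>l\<in>UNIV. \<zeta> t $ k * \<zeta> t $ l * pd c i (beta_coeff A H G c k l) (fst (\<gamma> t))))) (at t)"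
    if t: "t \<in> J" for t i
  proof -
    have "((\<lambda>s. x s $ i) has_field_derivative partial i (\<lambda>\<eta>. hamiltonian_coords A H G c (x t) \<eta>) (\<zeta> t)) (at t)"
      "((\<lambda>s. \<zeta> s $ i) has_field_derivative - partial i (\<lambda>y. hamiltonian_coords A H G c y (\<zeta> t)) (x t)) (at t)"
      using curve t c(1) unfolding hamiltonian_curve_on_def Let_def x_def \<zeta>_def J_def by blast+
    then show "((\<lambda>s. x s $ i) has_field_derivative (\<Sum>j\<in>UNIV. b i j (x t) * \<zeta> t $ j)) (at t)"
      "((\<lambda>s. \<zeta> s $ i) has_field_derivative
      - (1/2 * (\<Sum>k\<in>UNIV. \<Sum>l\<in>UNIV. \<zeta> t $ k * \<zeta> t $ l * pd c i (beta_coeff A H G c k l) (fst (\<gamma> t))))) (at t)"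
      using c(1) dom(1)[OF t]
      by (simp_all add: x_def b_def partial_hamiltonian_momentum partial_hamiltonian_position)
  qed
  have F: "smooth_on (coords c ` dom_chart c) F"
  proof -
    have "dom_chart c \<inter> topspace X = dom_chart c"
      using dom_chart_subset[OF c(1)] by blast
    then show ?thesis
      using f c(1) unfolding smooth_fun_on_def F_def by fastforce
  qed
  define h where "h t = (\<Sum>i\<in>UNIV. (\<Sum>j\<in>UNIV. b i j (x t) * \<zeta> t $ j) * partial i F (x t))" for t
  \<comment> \<open>The outer \<open>deriv\<close> acts on a function of \<open>t\<close>, so the
    inner one is evaluated for all \<open>t\<close> near 0 and not only at 0.\<close>
  have inner: "deriv (\<lambda>s. f (fst (\<Phi> (t + s) (q, ?p)))) 0 = h t" if t: "t \<in> J" for t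
  proof -
    have "((\<lambda>s. F (x s)) has_field_derivative h t) (at t)"
      unfolding h_def
      by (rule has_field_derivative_along_curve[OF dx[OF t]])
        (rule smooth_on_differentiable[OF F dom(2)[OF t]])
    then have "((\<lambda>s. f (fst (\<gamma> s))) has_field_derivative h t) (at t)"
      by (rule has_field_derivative_transform_within_open[OF _ \<open>open J\<close> t])
        (use c dom in \<open>simp add: F_def x_def\<close>)
    \<comment> \<open>Writing \<open>t\<close> as \<open>0 + t\<close> prepares the shift to a
      derivative in \<open>s\<close> at 0.\<close>
    then have "((\<lambda>s. f (fst (\<gamma> s))) has_field_derivative h t) (at (0 + t))"
      by simp
    then have "((\<lambda>s. f (fst (\<gamma> (s + t)))) has_field_derivative h t) (at 0)"
      by (simp only: DERIV_shift)
    then show ?thesis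
      by (simp add: \<gamma>_def add.commute DERIV_imp_deriv)
  qed
  have b_differentiable: "b i j differentiable (at (x 0))" for i j
    unfolding b_def[abs_def] by (rule beta_coeff_differentiable[OF c(1) dom(2)[OF J0]])
  have "deriv (\<lambda>t. deriv (\<lambda>s. f (fst (\<Phi> (t + s) (q, ?p)))) 0) 0 = deriv h 0"
    by (rule deriv_cong_ev) (use \<open>open J\<close> J0 inner in \<open>auto simp: eventually_nhds\<close>)
  \<comment> \<open>Three sources of change: \<open>b\<close> along the curve, the momenta by the
    second of Hamilton's equations, and the first derivatives of \<open>F\<close> along the
    curve.\<close>
  moreover have "(h has_field_derivative
      (\<Sum>i\<in>UNIV. (\<Sum>j\<in>UNIV. (\<Sum>l\<in>UNIV. (\<Sum>k\<in>UNIV. b l k (x 0) * \<zeta> 0 $ k) * partial l (b i j) (x 0)) * \<zeta> 0 $ j +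
          - (1/2 * (\<Sum>a\<in>UNIV. \<Sum>b\<in>UNIV. \<zeta> 0 $ a * \<zeta> 0 $ b * pd c j (beta_coeff A H G c a b) (fst (\<gamma> 0))))
            * b i j (x 0)) * partial i F (x 0) +
        (\<Sum>l\<in>UNIV. (\<Sum>k\<in>UNIV. b l k (x 0) * \<zeta> 0 $ k) * partial l (partial i F) (x 0)) *
          (\<Sum>j\<in>UNIV. b i j (x 0) * \<zeta> 0 $ j))) (at 0)"
    unfolding h_def
    by (intro DERIV_sum DERIV_mult has_field_derivative_along_curve dx d\<zeta> J0
        b_differentiable smooth_on_differentiable[OF smooth_on_partial[OF F]] dom(2) c(1))
  moreover have \<zeta>0: "\<zeta> 0 $ j = \<xi> j" for j
    using c v sym[of v "coord_vec A c j q"] by (simp add: \<zeta>_def momenta_def \<gamma>0 flat_def \<xi>_def H)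
  moreover have "(\<Sum>k\<in>UNIV. b i k (x 0) * \<xi> k) = comp v c $ i" for i
  proof -
    have "\<xi> k = (gram c q *v comp v c) $ k" for k
      using c v sym[of v "coord_vec A c k q"] by (simp add: \<xi>_def metric_coords H)
    then have "(\<Sum>k\<in>UNIV. b i k (x 0) * \<xi> k) = (matrix_inv (gram c q) *v (gram c q *v comp v c)) $ i"
      using c by (simp add: b_def x0 beta_coeff_eq matrix_vector_mult_def[of "matrix_inv _"])
    then show ?thesis
      using invertible_gram[OF c] by (simp add: matrix_vector_mul_assoc matrix_inv_mult)
  qed
  moreover have "partial l (b i j) (x 0) = pd c l (beta_coeff A H G c i j) q" for i j l
    by (simp add: pd_def x0 b_def[abs_def] o_def)
  moreover have "b i j (x 0) = beta_coeff A H G c i j q" for i j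
    using c by (simp add: b_def x0)
  moreover have "partial i F (x 0) = pd c i f q" for i
    by (simp add: pd_def F_def x0)
  moreover have "partial l (partial i F) (x 0) = pd c l (pd c i f) q" for i l
    unfolding pd_def[of c l] x0
    by (rule partial_cong[OF open_coords_image[OF c(1)]]) (use c in \<open>auto simp: pd_def F_def\<close>)
  ultimately have "deriv (\<lambda>t. deriv (\<lambda>s. f (fst (\<Phi> (t + s) (q, ?p)))) 0) 0 =
      (\<Sum>i\<in>UNIV. (\<Sum>j\<in>UNIV. (\<Sum>l\<in>UNIV. comp v c $ l * pd c l (beta_coeff A H G c i j) q) * \<xi> j +
          - (1/2 * (\<Sum>a\<in>UNIV. \<Sum>b\<in>UNIV. \<xi> a * \<xi> b * pd c j (beta_coeff A H G c a b) q))
            * beta_coeff A H G c i j q) * pd c i f q +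
        (\<Sum>l\<in>UNIV. comp v c $ l * pd c l (pd c i f) q) * comp v c $ i)"
    by (simp add: DERIV_imp_deriv \<gamma>0)
  then show ?thesis
    by (simp add: mult.commute add.commute)
qed

end


section \<open>Local expressions\<close>

context full_sub_riemannian
begin

text \<open>The common value of the averaged quadratic form, the expression in \<open>\<Gamma>\<close>, and the Laplace-Beltrami
  operator: it arises from \<open>flow_second_derivative\<close> by replacing \<open>\<xi>\<^sub>a \<xi>\<^sub>b\<close> with \<open>g\<^sub>a\<^sub>b\<close>.\<close>

definition local_operator :: "('a, 'n) chart \<Rightarrow> ('a \<Rightarrow> real) \<Rightarrow> 'a \<Rightarrow> real" where
  "local_operator c f q =
    (\<Sum>i\<in>UNIV. (\<Sum>j\<in>UNIV. beta_coeff A H G c i j q * pd c i (pd c j f) q) +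
      pd c i f q * (\<Sum>j\<in>UNIV. pd c j (beta_coeff A H G c i j) q -
        beta_coeff A H G c i j q *
          (1/2 * (\<Sum>a\<in>UNIV. \<Sum>b\<in>UNIV. metric_coeff A G c a b q * pd c j (beta_coeff A H G c a b) q))))"

text \<open>The components of \<open>v\<close> are inner products with the \<open>w i\<close>, its
  momenta inner products with the \<open>e i\<close>. Every summand of the second derivative then
  has exactly two such factors, so second moments suffice.\<close>

lemma horizontal_sub_laplacian_local:
  assumes flow: "hamiltonian_flow X A H G \<Phi>" and f: "smooth_fun_on A (topspace X) f"
    and c: "c \<in> A" "q \<in> dom_chart c" and rot: "rotation_invariant_probability H G q (U q)"
  shows "horizontal_sub_laplacian A G \<Phi> U f q = 1 / real CARD('n) * local_operator c f q"
proof -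
  interpret fibre_inner_product H G q by (rule fibre_chart[OF c])
  have H: "H q = tangent A q" by (rule full_chart[OF c])
  define e where "e i = coord_vec A c i q" for i
  define w where "w i = beta H G q (dx A c i q)" for i
  have [simp]: "e i \<in> H q" "w i \<in> H q" for i
    using c by (simp_all add: H e_def w_def)
  have comp_eq: "comp v c $ i = G q v (w i)" if "v \<in> H q" for v i
    using beta_dx_pairing[OF c, of v i] sym[of v "w i"] c that by (simp add: H w_def)
  have we: "G q (w i) (e j) = axis j 1 $ i" for i j
  proof -
    have "comp (e j) c = axis j 1" using c by (simp add: e_def)
    then show ?thesis using sym[of "w i" "e j"] comp_eq[of "e j" i] by simp
  qed
  obtain \<kappa> where \<kappa>: "\<And>a b. a \<in> H q \<Longrightarrow> b \<in> H q \<Longrightarrow> (\<integral>v. G q v a * G q v b \<partial>U q) = \<kappa> * G q a b"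
    using second_moment[OF rot] by blast
  \<comment> \<open>\<open>has_bochner_integral\<close> carries integrability and value together, so
    the long sums below are integrated in one structural pass.\<close>
  have moment: "has_bochner_integral (U q) (\<lambda>v. G q v a * G q v b) (\<kappa> * G q a b)"
    if "a \<in> H q" "b \<in> H q" for a b
    using integrable_inner_mult[OF rot that] \<kappa>[OF that] by (simp add: has_bochner_integral_iff)
  \<comment> \<open>A trace over the dual frames: the sum of <v, w_i> <v, e_i> is <v, v> = 1 on the
    sphere, and the sum of <w_i, e_i> is the dimension.\<close>
  have "\<kappa> * real CARD('n) = 1"
  proof -
    have "(\<integral>v. (\<Sum>i\<in>UNIV. G q v (w i) * G q v (e i)) \<partial>U q) = (\<Sum>i\<in>UNIV. \<kappa> * G q (w i) (e i))"
      by (intro has_bochner_integral_integral_eq has_bochner_integral_sum moment) simp_all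
    moreover have "(\<integral>v. (\<Sum>i\<in>UNIV. G q v (w i) * G q v (e i)) \<partial>U q) = (\<integral>v. 1 \<partial>U q)"
    proof (intro Bochner_Integration.integral_cong refl)
      fix v assume "v \<in> space (U q)"
      then have v: "v \<in> H q" "G q v v = 1" by (auto simp: space_eq[OF rot])
      have "(\<Sum>i\<in>UNIV. G q v (w i) * G q v (e i)) = (\<Sum>i\<in>UNIV. comp v c $ i * G q (e i) v)"
        using v by (intro sum.cong refl) (simp add: comp_eq sym)
      also have "\<dots> = G q (\<Sum>i\<in>UNIV. comp v c $ i *\<^sub>R e i) v"
        using v by (simp add: sum_left)
      also have "\<dots> = 1"
        using tangent_expansion[OF c, of v] v by (simp add: H e_def)
      finally show "(\<Sum>i\<in>UNIV. G q v (w i) * G q v (e i)) = 1" .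
    qed
    moreover have "(\<integral>v. 1 \<partial>U q) = (1::real)"
      using emeasure_space_eq[OF rot] by (simp add: measure_def)
    ultimately show ?thesis by (simp add: we axis_def mult.commute)
  qed
  then have \<kappa>_eq: "\<kappa> = 1 / real CARD('n)" by (simp add: field_simps)
  let ?\<beta> = "\<lambda>i j. beta_coeff A H G c i j"
  have "horizontal_sub_laplacian A G \<Phi> U f q =
      (\<integral>v. (\<Sum>i\<in>UNIV. (\<Sum>j\<in>UNIV. G q v (w j) * G q v (w i) * pd c j (pd c i f) q) +
        pd c i f q * (\<Sum>j\<in>UNIV. (\<Sum>l\<in>UNIV. G q v (w l) * G q v (e j) * pd c l (?\<beta> i j) q) -
          ?\<beta> i j q * (1/2 * (\<Sum>a\<in>UNIV. \<Sum>b\<in>UNIV. G q v (e a) * G q v (e b) * pd c j (?\<beta> a b) q)))) \<partial>U q)"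
    unfolding horizontal_sub_laplacian_def
  proof (intro Bochner_Integration.integral_cong refl)
    fix v assume "v \<in> space (U q)"
    then have v: "v \<in> H q" by (simp add: space_eq[OF rot])
    then have "v \<in> tangent A q" by (simp add: H)
    from flow_second_derivative[OF flow f c this]
    show "deriv (\<lambda>t. deriv (\<lambda>s. f (fst (\<Phi> (t + s) (q, flat A G q v)))) 0) 0 =
      (\<Sum>i\<in>UNIV. (\<Sum>j\<in>UNIV. G q v (w j) * G q v (w i) * pd c j (pd c i f) q) +
        pd c i f q * (\<Sum>j\<in>UNIV. (\<Sum>l\<in>UNIV. G q v (w l) * G q v (e j) * pd c l (?\<beta> i j) q) -
          ?\<beta> i j q * (1/2 * (\<Sum>a\<in>UNIV. \<Sum>b\<in>UNIV. G q v (e a) * G q v (e b) * pd c j (?\<beta> a b) q))))"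
      by (simp only: comp_eq[OF v] e_def[symmetric] sum_distrib_left mult.assoc mult.commute mult.left_commute)
  qed
  also have "\<dots> =
      (\<Sum>i\<in>UNIV. (\<Sum>j\<in>UNIV. (\<kappa> * G q (w j) (w i)) * pd c j (pd c i f) q) +
        pd c i f q * (\<Sum>j\<in>UNIV. (\<Sum>l\<in>UNIV. (\<kappa> * G q (w l) (e j)) * pd c l (?\<beta> i j) q) -
          ?\<beta> i j q * (1/2 * (\<Sum>a\<in>UNIV. \<Sum>b\<in>UNIV. (\<kappa> * G q (e a) (e b)) * pd c j (?\<beta> a b) q))))"
    by (intro has_bochner_integral_integral_eq has_bochner_integral_sum has_bochner_integral_add
        has_bochner_integral_diff has_bochner_integral_mult_right has_bochner_integral_mult_left moment) simp_all
  \<comment> \<open>The mixed products <w_l, e_j> are Kronecker symbols, so the term from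
    differentiating \<open>beta\<close> along the curve collapses to a divergence of
    \<open>beta\<close>.\<close>
  also have "\<dots> = \<kappa> * (\<Sum>i\<in>UNIV. (\<Sum>j\<in>UNIV. G q (w j) (w i) * pd c j (pd c i f) q) +
        pd c i f q * (\<Sum>j\<in>UNIV. (\<Sum>l\<in>UNIV. axis j 1 $ l * pd c l (?\<beta> i j) q) -
          ?\<beta> i j q * (1/2 * (\<Sum>a\<in>UNIV. \<Sum>b\<in>UNIV. G q (e a) (e b) * pd c j (?\<beta> a b) q))))"
    by (simp only: we sum_distrib_left distrib_left right_diff_distrib ac_simps)
  also have "\<dots> = \<kappa> * ((\<Sum>i\<in>UNIV. \<Sum>j\<in>UNIV. ?\<beta> j i q * pd c j (pd c i f) q) +
      (\<Sum>i\<in>UNIV. pd c i f q * (\<Sum>j\<in>UNIV. pd c j (?\<beta> i j) q -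
        ?\<beta> i j q * (1/2 * (\<Sum>a\<in>UNIV. \<Sum>b\<in>UNIV. metric_coeff A G c a b q * pd c j (?\<beta> a b) q)))))"
    by (simp add: beta_coeff_def[of _ _ _ _ _ _ q] metric_coeff_def w_def e_def sum.distrib)
  also have "(\<Sum>i\<in>UNIV. \<Sum>j\<in>UNIV. ?\<beta> j i q * pd c j (pd c i f) q) =
      (\<Sum>i\<in>UNIV. \<Sum>j\<in>UNIV. ?\<beta> i j q * pd c i (pd c j f) q)"
    by (rule sum.swap)
  finally show ?thesis
    by (simp add: local_operator_def sum.distrib \<kappa>_eq)
qed

section \<open>Contraction of Gamma with the metric\<close>

lemma pd_beta_coeff_sym:
  "c \<in> A \<Longrightarrow> q \<in> dom_chart c \<Longrightarrow> pd c l (beta_coeff A H G c i j) q = pd c l (beta_coeff A H G c j i) q"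
  by (intro pd_cong beta_coeff_sym)

text \<open>Contracted with the metric, the first two summands of \<open>Gamma_coeff\<close>
  coincide by symmetry and each give the divergence of row \<open>k\<close> of \<open>beta\<close>,
  so together they absorb the factor 1/2. In the third summand the 1/2 survives.\<close>

lemma Gamma_form_eq:
  assumes c: "c \<in> A" "q \<in> dom_chart c"
  shows "(\<Sum>i\<in>UNIV. \<Sum>j\<in>UNIV. beta_coeff A H G c i j q * pd c i (pd c j f) q -
      (\<Sum>k\<in>UNIV. Gamma_coeff A H G c i j k q * metric_coeff A G c i j q * pd c k f q)) = local_operator c f q"
proof -
  define \<beta> where "\<beta> i j = beta_coeff A H G c i j q" for i j
  define \<delta> where "\<delta> l i j = pd c l (beta_coeff A H G c i j) q" for l i j
  define N where "N i j = metric_coeff A G c i j q" for i j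
  have inv: "(\<Sum>i\<in>UNIV. \<beta> l i * N i j) = (if l = j then 1 else 0)" for l j
    unfolding \<beta>_def N_def by (rule beta_metric_inverse[OF c])
  have sym: "\<beta> i j = \<beta> j i" "N i j = N j i" "\<delta> l i j = \<delta> l j i" for i j l
    unfolding \<beta>_def N_def \<delta>_def by (intro beta_coeff_sym metric_coeff_sym pd_beta_coeff_sym c)+
  have contract: "(\<Sum>i\<in>UNIV. \<Sum>j\<in>UNIV. Gamma_coeff A H G c i j k q * N i j) =
      - (\<Sum>j\<in>UNIV. \<delta> j k j - \<beta> k j * (1/2 * (\<Sum>a\<in>UNIV. \<Sum>b\<in>UNIV. N a b * \<delta> j a b)))" for k
  proof -
    have one: "(\<Sum>i\<in>UNIV. \<Sum>j\<in>UNIV. \<Sum>l\<in>UNIV. \<beta> i l * \<delta> l j k * N i j) = (\<Sum>j\<in>UNIV. \<delta> j k j)"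
    proof -
      have "(\<Sum>i\<in>UNIV. \<Sum>j\<in>UNIV. \<Sum>l\<in>UNIV. \<beta> i l * \<delta> l j k * N i j) =
          (\<Sum>j\<in>UNIV. \<Sum>i\<in>UNIV. \<Sum>l\<in>UNIV. \<delta> l j k * (\<beta> l i * N i j))"
        by (subst sum.swap) (simp add: sym(1) ac_simps)
      \<comment> \<open>With the sum over \<open>i\<close> innermost, \<open>\<beta>\<close> meets
        its inverse \<open>N\<close>.\<close>
      also have "\<dots> = (\<Sum>j\<in>UNIV. \<Sum>l\<in>UNIV. \<delta> l j k * (\<Sum>i\<in>UNIV. \<beta> l i * N i j))"
        unfolding sum_distrib_left by (intro sum.cong refl sum.swap)
      also have "\<dots> = (\<Sum>j\<in>UNIV. \<delta> j k j)"
        by (simp add: inv sym(3)[of _ _ k] if_distrib[of "\<lambda>y. _ * y"] cong: if_cong)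
      finally show ?thesis .
    qed
    have two: "(\<Sum>i\<in>UNIV. \<Sum>j\<in>UNIV. \<Sum>l\<in>UNIV. \<beta> j l * \<delta> l i k * N i j) = (\<Sum>j\<in>UNIV. \<delta> j k j)"
      using one by (subst sum.swap) (simp add: sym(2))
    have three: "(\<Sum>i\<in>UNIV. \<Sum>j\<in>UNIV. \<Sum>l\<in>UNIV. \<beta> l k * \<delta> l i j * N i j) =
        (\<Sum>l\<in>UNIV. \<beta> k l * (\<Sum>a\<in>UNIV. \<Sum>b\<in>UNIV. N a b * \<delta> l a b))"
    proof -
      have "(\<Sum>i\<in>UNIV. \<Sum>j\<in>UNIV. \<Sum>l\<in>UNIV. \<beta> l k * \<delta> l i j * N i j) =
          (\<Sum>i\<in>UNIV. \<Sum>l\<in>UNIV. \<Sum>j\<in>UNIV. \<beta> k l * (N i j * \<delta> l i j))"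
        by (rule sum.cong[OF refl], subst sum.swap) (simp add: sym(1)[of k] ac_simps)
      then show ?thesis
        by (subst (asm) sum.swap) (simp add: sum_distrib_left)
    qed
    have half: "(\<Sum>j\<in>UNIV. \<beta> k j * (1/2 * s j)) = 1/2 * (\<Sum>j\<in>UNIV. \<beta> k j * s j)" for s
      by (simp only: sum_distrib_left mult.left_commute)
    have "(\<Sum>i\<in>UNIV. \<Sum>j\<in>UNIV. Gamma_coeff A H G c i j k q * N i j) =
        - 1/2 * ((\<Sum>i\<in>UNIV. \<Sum>j\<in>UNIV. \<Sum>l\<in>UNIV. \<beta> i l * \<delta> l j k * N i j) +
          (\<Sum>i\<in>UNIV. \<Sum>j\<in>UNIV. \<Sum>l\<in>UNIV. \<beta> j l * \<delta> l i k * N i j) -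
          (\<Sum>i\<in>UNIV. \<Sum>j\<in>UNIV. \<Sum>l\<in>UNIV. \<beta> l k * \<delta> l i j * N i j))"
      unfolding Gamma_coeff_def \<beta>_def[symmetric] \<delta>_def[symmetric]
      by (simp only: sum_distrib_left sum_distrib_right sum.distrib[symmetric] sum_subtractf[symmetric]
          distrib_right left_diff_distrib mult.assoc)
    then show ?thesis
      unfolding one two three sum_subtractf half by (simp add: diff_divide_distrib)
  qed
  have "(\<Sum>i\<in>UNIV. \<Sum>j\<in>UNIV. \<Sum>k\<in>UNIV. Gamma_coeff A H G c i j k q * N i j * pd c k f q) =
      (\<Sum>k\<in>UNIV. pd c k f q * (\<Sum>i\<in>UNIV. \<Sum>j\<in>UNIV. Gamma_coeff A H G c i j k q * N i j))"
  proof -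
    have "(\<Sum>i\<in>UNIV. \<Sum>j\<in>UNIV. \<Sum>k\<in>UNIV. Gamma_coeff A H G c i j k q * N i j * pd c k f q) =
        (\<Sum>i\<in>UNIV. \<Sum>k\<in>UNIV. \<Sum>j\<in>UNIV. pd c k f q * (Gamma_coeff A H G c i j k q * N i j))"
      by (rule sum.cong[OF refl], subst sum.swap) (simp add: ac_simps)
    then show ?thesis
      by (subst (asm) sum.swap) (simp add: sum_distrib_left)
  qed
  then have "(\<Sum>i\<in>UNIV. \<Sum>j\<in>UNIV. \<beta> i j * pd c i (pd c j f) q -
      (\<Sum>k\<in>UNIV. Gamma_coeff A H G c i j k q * N i j * pd c k f q)) =
    (\<Sum>i\<in>UNIV. \<Sum>j\<in>UNIV. \<beta> i j * pd c i (pd c j f) q) +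
    (\<Sum>k\<in>UNIV. pd c k f q * (\<Sum>j\<in>UNIV. \<delta> j k j - \<beta> k j * (1/2 * (\<Sum>a\<in>UNIV. \<Sum>b\<in>UNIV. N a b * \<delta> j a b))))"
    by (simp only: sum_subtractf contract mult_minus_right sum_negf diff_minus_eq_add)
  then show ?thesis
    unfolding local_operator_def \<beta>_def N_def \<delta>_def by (simp add: sum.distrib)
qed

section \<open>The Laplace-Beltrami operator in coordinates\<close>

lemma has_field_derivative_pd:
  assumes "(\<lambda>y. h (inv_chart c y)) differentiable (at (coords c q))"
  shows "((\<lambda>t. h (inv_chart c (coords c q + t *\<^sub>R axis i 1))) has_field_derivative pd c i h q) (at 0)"
  using has_field_derivative_partial[OF assms, of i] by (simp add: pd_def o_def)

lemma pd_eqI: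
  assumes "((\<lambda>t. h (inv_chart c (coords c q + t *\<^sub>R axis i 1))) has_field_derivative D) (at 0)"
  shows "pd c i h q = D"
  using DERIV_imp_deriv[OF assms] by (simp add: pd_def partial_def o_def)

lemma trace_inverse_gram_derivative:
  assumes c: "c \<in> A" "q \<in> dom_chart c"
  shows "trace (matrix_inv (gram c q) ** (\<chi> a b. pd c i (metric_coeff A G c a b) q)) =
    - (\<Sum>a\<in>UNIV. \<Sum>b\<in>UNIV. metric_coeff A G c a b q * pd c i (beta_coeff A H G c a b) q)"
proof -
  let ?K = "\<lambda>q. \<Sum>a\<in>UNIV. \<Sum>b\<in>UNIV. beta_coeff A H G c a b q * metric_coeff A G c b a q"
  have x: "coords c q \<in> coords c ` dom_chart c" using c by simp
  note D = has_field_derivative_pd[OF beta_coeff_differentiable[OF c(1) x]]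
    has_field_derivative_pd[OF metric_coeff_differentiable[OF c(1) x]]
  have "pd c i ?K q = (\<Sum>a\<in>UNIV. \<Sum>b\<in>UNIV.
      pd c i (beta_coeff A H G c a b) q * metric_coeff A G c b a (inv_chart c (coords c q + 0 *\<^sub>R axis i 1)) +
      pd c i (metric_coeff A G c b a) q * beta_coeff A H G c a b (inv_chart c (coords c q + 0 *\<^sub>R axis i 1)))"
    by (intro pd_eqI DERIV_sum DERIV_mult D)
  moreover have "pd c i ?K q = pd c i (\<lambda>q. real CARD('n)) q"
    by (rule pd_cong[OF c]) (use c in \<open>simp add: beta_metric_inverse\<close>)
  moreover have "pd c i (\<lambda>q. real CARD('n)) q = 0"
    by (simp add: pd_def o_def partial_const)
  ultimately have "(\<Sum>a\<in>UNIV. \<Sum>b\<in>UNIV. beta_coeff A H G c a b q * pd c i (metric_coeff A G c b a) q) =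
      - (\<Sum>a\<in>UNIV. \<Sum>b\<in>UNIV. metric_coeff A G c b a q * pd c i (beta_coeff A H G c a b) q)"
    using c by (simp add: sum.distrib mult.commute)
  then show ?thesis
    using c by (simp add: trace_def matrix_matrix_mult_def beta_coeff_eq[symmetric] metric_coeff_sym[OF c])
qed

lemma laplace_beltrami_local:
  assumes f: "smooth_fun_on A (topspace X) f" and c: "c \<in> A" "q \<in> dom_chart c"
  shows "laplace_beltrami A G c f q = local_operator c f q"
proof -
  let ?\<beta> = "\<lambda>i j. beta_coeff A H G c i j"
  define T where "T i = (\<Sum>a\<in>UNIV. \<Sum>b\<in>UNIV. metric_coeff A G c a b q * pd c i (?\<beta> a b) q)" for i
  define W where "W = sqrt (det (gram c q))"
  have W: "W \<noteq> 0"
    using invertible_gram[OF c] by (simp add: W_def invertible_det_nz)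
  have x: "coords c q \<in> coords c ` dom_chart c" using c by simp
  have density: "volume_density A G c q' = sqrt (det (gram c q'))" for q'
    by (simp add: volume_density_def gram_def)
  have gradient: "comp (gradient A G c f q') c $ i = (\<Sum>j\<in>UNIV. ?\<beta> i j q' * pd c j f q')"
    if "q' \<in> dom_chart c" for q' i
    using c that by (simp add: gradient_def differential_def Riesz matrix_vector_mult_def beta_coeff_eq)
  have df: "(\<lambda>y. pd c j f (inv_chart c y)) differentiable (at (coords c q))" for j
  proof (rule differentiable_cong_open[OF open_coords_image[OF c(1)] x])
    have "dom_chart c \<inter> topspace X = dom_chart c"
      using dom_chart_subset[OF c(1)] by blast
    then have "smooth_on (coords c ` dom_chart c) (f \<circ> inv_chart c)"
      using f c(1) unfolding smooth_fun_on_def by fastforce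
    then show "partial j (f \<circ> inv_chart c) differentiable (at (coords c q))"
      by (intro smooth_on_differentiable[OF smooth_on_partial x])
  qed (simp add: pd_def)
  \<comment> \<open>The product rule leaves the density \<open>W\<close> as a factor of every term;
    the division in \<open>divergence\<close> removes it.\<close>
  have term_eq: "pd c i (\<lambda>q'. volume_density A G c q' * comp (gradient A G c f q') c $ i) q =
      W * ((\<Sum>j\<in>UNIV. ?\<beta> i j q * pd c i (pd c j f) q) + (\<Sum>j\<in>UNIV. pd c i (?\<beta> i j) q * pd c j f q) -
        1/2 * T i * (\<Sum>j\<in>UNIV. ?\<beta> i j q * pd c j f q))" for i
  proof -
    let ?l = "\<lambda>t. inv_chart c (coords c q + t *\<^sub>R axis i 1)"
    have l0: "?l 0 = q" using c by simp
    have "((\<lambda>t. gram c (?l t) $ a $ b) has_field_derivative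
        (\<chi> a b. pd c i (metric_coeff A G c a b) q) $ a $ b) (at 0)" for a b
      using has_field_derivative_pd[OF metric_coeff_differentiable[OF c(1) x]] by (simp add: gram_def)
    from has_field_derivative_sqrt_det[OF this, of "matrix_inv (gram c q)"]
    have "((\<lambda>t. sqrt (det (gram c (?l t)))) has_field_derivative W * (- T i / 2)) (at 0)"
      using invertible_gram[OF c] l0
      by (simp add: matrix_inv_mult trace_inverse_gram_derivative[OF c] T_def W_def)
    moreover have "((\<lambda>t. \<Sum>j\<in>UNIV. ?\<beta> i j (?l t) * pd c j f (?l t)) has_field_derivative
        (\<Sum>j\<in>UNIV. pd c i (?\<beta> i j) q * pd c j f (?l 0) + pd c i (pd c j f) q * ?\<beta> i j (?l 0))) (at 0)"
      by (intro DERIV_sum DERIV_mult has_field_derivative_pd df beta_coeff_differentiable[OF c(1) x])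
    ultimately have "((\<lambda>t. sqrt (det (gram c (?l t))) * (\<Sum>j\<in>UNIV. ?\<beta> i j (?l t) * pd c j f (?l t)))
        has_field_derivative W * (- T i / 2) * (\<Sum>j\<in>UNIV. ?\<beta> i j (?l 0) * pd c j f (?l 0)) +
          (\<Sum>j\<in>UNIV. pd c i (?\<beta> i j) q * pd c j f (?l 0) + pd c i (pd c j f) q * ?\<beta> i j (?l 0)) *
            sqrt (det (gram c (?l 0)))) (at 0)"
      by (rule DERIV_mult)
    from pd_eqI[OF this]
    have "pd c i (\<lambda>q'. sqrt (det (gram c q')) * (\<Sum>j\<in>UNIV. ?\<beta> i j q' * pd c j f q')) q =
        W * (- T i / 2) * (\<Sum>j\<in>UNIV. ?\<beta> i j q * pd c j f q) +
          (\<Sum>j\<in>UNIV. pd c i (?\<beta> i j) q * pd c j f q + pd c i (pd c j f) q * ?\<beta> i j q) * W"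
      unfolding l0 W_def[symmetric] .
    moreover have "pd c i (\<lambda>q'. volume_density A G c q' * comp (gradient A G c f q') c $ i) q =
        pd c i (\<lambda>q'. sqrt (det (gram c q')) * (\<Sum>j\<in>UNIV. ?\<beta> i j q' * pd c j f q')) q"
      by (rule pd_cong[OF c]) (simp add: density gradient)
    ultimately show ?thesis
      by (simp add: sum.distrib algebra_simps)
  qed
  have "laplace_beltrami A G c f q = (\<Sum>i\<in>UNIV. (\<Sum>j\<in>UNIV. ?\<beta> i j q * pd c i (pd c j f) q) +
      (\<Sum>j\<in>UNIV. pd c i (?\<beta> i j) q * pd c j f q) - 1/2 * T i * (\<Sum>j\<in>UNIV. ?\<beta> i j q * pd c j f q))"
    unfolding laplace_beltrami_def divergence_def term_eq density[of q] W_def[symmetric]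
    using W by (simp flip: sum_distrib_left)
  \<comment> \<open>Symmetry of \<open>beta\<close> moves the index of the differentiated
    \<open>f\<close> to the first slot, so that interchanging the sums reproduces
    \<open>local_operator\<close>.\<close>
  also have "\<dots> = (\<Sum>i\<in>UNIV. \<Sum>j\<in>UNIV. ?\<beta> i j q * pd c i (pd c j f) q) +
      (\<Sum>i\<in>UNIV. \<Sum>j\<in>UNIV. pd c j f q * (pd c i (?\<beta> j i) q - ?\<beta> j i q * (1/2 * T i)))"
    using beta_coeff_sym[OF c] pd_beta_coeff_sym[OF c]
    by (simp add: sum.distrib sum_subtractf sum_distrib_left right_diff_distrib ac_simps)
  also have "(\<Sum>i\<in>UNIV. \<Sum>j\<in>UNIV. pd c j f q * (pd c i (?\<beta> j i) q - ?\<beta> j i q * (1/2 * T i))) =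
      (\<Sum>i\<in>UNIV. pd c i f q * (\<Sum>j\<in>UNIV. pd c j (?\<beta> i j) q - ?\<beta> i j q * (1/2 * T j)))"
    unfolding sum_distrib_left by (rule sum.swap)
  finally show ?thesis
    by (simp add: local_operator_def T_def sum.distrib)
qed

section \<open>Compatible metrics: existence, uniqueness and transfer\<close>

lemma compatible_metric_self: "compatible_metric X A H G G"
  unfolding compatible_metric_def riemannian_metric_def smooth_fibre_metric_def
proof (intro conjI)
  \<comment> \<open>An open set consists of points of the manifold, so tangent fields on it take
    values in the fibres \<open>H\<close>.\<close>
  show "\<forall>W Y Z. openin X W \<and> smooth_field_on A W Y \<and> smooth_field_on A W Z \<and>
      (\<forall>q\<in>W. Y q \<in> tangent A q \<and> Z q \<in> tangent A q) \<longrightarrow>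
      smooth_fun_on A W (\<lambda>q. G q (Y q) (Z q))"
  proof (intro allI impI)
    fix W Y Z
    assume *: "openin X W \<and> smooth_field_on A W Y \<and> smooth_field_on A W Z \<and>
      (\<forall>q\<in>W. Y q \<in> tangent A q \<and> Z q \<in> tangent A q)"
    then have "\<forall>q\<in>W. Y q \<in> H q \<and> Z q \<in> H q"
      using full openin_subset by blast
    with * show "smooth_fun_on A W (\<lambda>q. G q (Y q) (Z q))"
      using fibre_metric unfolding smooth_fibre_metric_def by simp
  qed
qed (use fibre_metric full in \<open>simp_all add: smooth_fibre_metric_def\<close>)

context
  fixes g :: "('a, 'n) metric"
  assumes compatible: "compatible_metric X A H G g"
begin

text \<open>Agreement on the fibres is agreement on whole tangent spaces here. Elsewhere
  \<open>g\<close> and \<open>G\<close> may differ as functions, so each expression in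
  \<open>g\<close> has to be transferred.\<close>

lemma compatible_metric_eq:
  "q \<in> topspace X \<Longrightarrow> u \<in> tangent A q \<Longrightarrow> v \<in> tangent A q \<Longrightarrow> g q u v = G q u v"
  using compatible full by (simp add: compatible_metric_def)

lemma compatible_metric_chart_eq:
  "c \<in> A \<Longrightarrow> q \<in> dom_chart c \<Longrightarrow> u \<in> tangent A q \<Longrightarrow> v \<in> tangent A q \<Longrightarrow> g q u v = G q u v"
  by (simp add: compatible_metric_eq dom_chart_subset)

lemma metric_coeff_compatible:
  "c \<in> A \<Longrightarrow> q \<in> dom_chart c \<Longrightarrow> metric_coeff A g c i j q = metric_coeff A G c i j q"
  by (simp add: metric_coeff_def compatible_metric_chart_eq)

lemma horizontal_sub_laplacian_compatible:
  assumes c: "c \<in> A" "q \<in> dom_chart c" and rot: "rotation_invariant_probability H G q (U q)"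
  shows "horizontal_sub_laplacian A g \<Phi> U f q = horizontal_sub_laplacian A G \<Phi> U f q"
  unfolding horizontal_sub_laplacian_def
proof (intro Bochner_Integration.integral_cong refl)
  fix v assume "v \<in> space (U q)"
  then have "v \<in> tangent A q"
    using rot full_chart[OF c] by (simp add: rotation_invariant_probability_def horizontal_sphere_def)
  \<comment> \<open>\<open>flat\<close> is extended by zero off the tangent space, so equality on
    tangent vectors gives equal functions and hence the same starting point of the flow.\<close>
  then have "flat A g q v = flat A G q v"
    using compatible_metric_chart_eq[OF c] by (simp add: flat_def fun_eq_iff)
  then show "deriv (\<lambda>t. deriv (\<lambda>s. f (fst (\<Phi> (t + s) (q, flat A g q v)))) 0) 0 =
      deriv (\<lambda>t. deriv (\<lambda>s. f (fst (\<Phi> (t + s) (q, flat A G q v)))) 0) 0"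
    by simp
qed

lemma laplace_beltrami_compatible:
  assumes c: "c \<in> A" "q \<in> dom_chart c"
  shows "laplace_beltrami A g c f q = laplace_beltrami A G c f q"
proof -
  have density: "volume_density A g c q' = volume_density A G c q'" if "q' \<in> dom_chart c" for q'
    using metric_coeff_compatible[OF c(1) that] by (simp add: volume_density_def)
  have gradient: "gradient A g c f q' = gradient A G c f q'" if "q' \<in> dom_chart c" for q'
    unfolding gradient_def using compatible_metric_chart_eq[OF c(1) that]
    by (intro arg_cong[where f = The] ext) auto
  show ?thesis
    unfolding laplace_beltrami_def divergence_def density[OF c(2)]
    by (intro arg_cong2[where f = "(/)"] sum.cong pd_cong[OF c] refl) (simp add: density gradient)
qed

end

end

section \<open>Rank, uniqueness of the metric and both formulas\<close>

theorem mainTheorem5: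
  fixes X :: "'a topology" and A :: "('a, 'n::finite) chart set"
    and H :: "'a \<Rightarrow> ('a, 'n) tvec set" and G :: "('a, 'n) metric" and m :: nat
    and \<Phi> :: "real \<Rightarrow> 'a \<times> ('a, 'n) covec \<Rightarrow> 'a \<times> ('a, 'n) covec"
    and U :: "'a \<Rightarrow> ('a, 'n) tvec measure"
  assumes sub_riemannian: "sub_riemannian_manifold X A H G m"
    and full: "\<forall>q\<in>topspace X. H q = tangent A q"
    and flow: "hamiltonian_flow X A H G \<Phi>"
    and rotation_invariant: "\<forall>x\<in>topspace X. rotation_invariant_probability H G x (U x)"
  shows "m = CARD('n) \<and>
    compatible_metric X A H G G \<and>
    (\<forall>g. compatible_metric X A H G g \<longrightarrow>
      (\<forall>q\<in>topspace X. \<forall>u\<in>tangent A q. \<forall>v\<in>tangent A q. g q u v = G q u v) \<and>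
      (\<forall>f. test_function X A f \<longrightarrow>
        (\<forall>c\<in>A. \<forall>q\<in>dom_chart c.
          horizontal_sub_laplacian A g \<Phi> U f q =
            1 / real m * (\<Sum>i\<in>UNIV. \<Sum>j\<in>UNIV.
              beta_coeff A H G c i j q * pd c i (pd c j f) q
              - (\<Sum>k\<in>UNIV. Gamma_coeff A H G c i j k q * metric_coeff A g c i j q * pd c k f q)) \<and>
          horizontal_sub_laplacian A g \<Phi> U f q = 1 / real m * laplace_beltrami A g c f q)))"
proof -
  have manifold: "connected_manifold X A" and subbundle: "smooth_subbundle X A H m"
    and fibre_metric: "smooth_fibre_metric X A H G"
    using sub_riemannian by (simp_all add: sub_riemannian_manifold_def)
  interpret full_sub_riemannian X A H G
    using manifold fibre_metric full by unfold_locales (auto simp: connected_manifold_def)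
  \<comment> \<open>The rank is read off at one point, which exists because a connected manifold is
    nonempty by definition.\<close>
  have m: "m = CARD('n)"
  proof -
    obtain q where q: "q \<in> topspace X"
      using manifold unfolding connected_manifold_def by blast
    moreover have "(\<Union>c\<in>A. dom_chart c) = topspace X"
      using smooth_structure by (simp add: smooth_structure_def)
    ultimately obtain c where "c \<in> A" "q \<in> dom_chart c" by blast
    then have "dim (tangent A q) = CARD('n)" by (rule dim_tangent)
    then show ?thesis
      using subbundle full q by (simp add: smooth_subbundle_def)
  qed
  show ?thesis
  proof (intro conjI m compatible_metric_self allI impI ballI)
    fix g q u v assume "compatible_metric X A H G g" "q \<in> topspace X" "u \<in> tangent A q" "v \<in> tangent A q"
    then show "g q u v = G q u v" by (rule compatible_metric_eq)
  next
    fix g f c q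
    assume g: "compatible_metric X A H G g" and "test_function X A f" and c: "c \<in> A" "q \<in> dom_chart c"
    then have f: "smooth_fun_on A (topspace X) f" by (simp add: test_function_def)
    have rot: "rotation_invariant_probability H G q (U q)"
      using rotation_invariant dom_chart_subset[OF c] by blast
    have L: "horizontal_sub_laplacian A g \<Phi> U f q = 1 / real m * local_operator c f q"
      using horizontal_sub_laplacian_compatible[OF g c, of U, OF rot]
        horizontal_sub_laplacian_local[where U = U, OF flow f c rot] by (simp add: m)
    show "horizontal_sub_laplacian A g \<Phi> U f q =
        1 / real m * (\<Sum>i\<in>UNIV. \<Sum>j\<in>UNIV.
          beta_coeff A H G c i j q * pd c i (pd c j f) q
          - (\<Sum>k\<in>UNIV. Gamma_coeff A H G c i j k q * metric_coeff A g c i j q * pd c k f q))"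
      unfolding L metric_coeff_compatible[OF g c] Gamma_form_eq[OF c] ..
    show "horizontal_sub_laplacian A g \<Phi> U f q = 1 / real m * laplace_beltrami A g c f q"
      unfolding L laplace_beltrami_compatible[OF g c] laplace_beltrami_local[OF f c] ..
  qed
qed

end
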